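(* Let $p>0$, let $i\in\mathbb S^2$, let $a\in\mathbb B_i$ and let $T_a$ be the associated slice regular Möbius transformation. Then for $f\in\mathfrak B_{p,i}$ we have $f\circ_iT_a\in\mathfrak B_{p,i}$.
   Context: $\mathbb H$ denotes the quaternions with real part coordinate $x_0$, $\mathbb S^2$ the sphere of purely imaginary unit quaternions, $\mathbb C(i)=\{x+iy:x,y\in\mathbb R\}$ for $i\in\mathbb S^2$, $\mathbb B$ the open unit ball of $\mathbb H$, $\mathbb B_i=\mathbb B\cap\mathbb C(i)$. A real differentiable function $f:\mathbb B\to\mathbb H$ is (left) slice regular if for every $i\in\mathbb S^2$, $\left(\frac{\partial}{\partial x}+i\frac{\partial}{\partial y}\right)f(x+iy)=0$ on $\mathbb B_i$; $\mathcal{SR}(\mathbb B)$ is the set of these functions. $dA_i=\frac1\pi dx\,dy$ on $\mathbb B_i$ and $d\lambda_i(z)=\frac{dA_i(z)}{(1-|z|^2)^2}$. For $p>0$, $\mathfrak B_{p,i}$ is the quaternionic right linear space of $f\in\mathcal{SR}(\mathbb B)$ such that $\int_{\mathbb B_i}|(1-|z|^2)^n\partial_{x_0}^nf(z)|^pd\lambda_i(z)<\infty$ for some $n\in\mathbb N$ with $np>1$ (this does not depend on the choice of $n$). $Q_i[f]=f|_{\mathbb B_i}$. For $j\in\mathbb S^2$ orthogonal to $i$, every $f\in\mathcal{SR}(\mathbb B)$ satisfies $Q_i[f]=f_1+f_2j$ with $f_1,f_2:\mathbb B_i\to\mathbb C(i)$ holomorphic. For $g=g_1+g_2j$ with $g_1,g_2$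 holomorphic $\mathbb B_i\to\mathbb C(i)$, $P_i[g]\in\mathcal{SR}(\mathbb B)$ is the slice regular extension $P_i[g](x+I_qy)=\frac12[(1+I_qi)g(x-yi)+(1-I_qi)g(x+yi)]$. $T_a(q)=(1-q\bar a)^{-\ast}\ast(a-q)$, where $\ast$ is the slice regular product (for power series, $(\sum q^na_n)\ast(\sum q^nb_n)=\sum_nq^n\sum_ka_kb_{n-k}$) and $(1-q\bar a)^{-\ast}=\sum_{n\ge0}q^n\bar a^n$; for $a\in\mathbb B_i$, on $\mathbb B_i$ it equals $\frac{a-z}{1-\bar az}$. The composition is $f\circ_iT_a:=P_i[f_1\circ Q_i[T_a]]+P_i[f_2\circ Q_i[T_a]]\,j$. *)

theory Defs
  imports "HOL-Analysis.Analysis"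
begin

section \<open>Quaternions\<close>

datatype quat = Quat (qRe: real) (qIm1: real) (qIm2: real) (qIm3: real)

lemma quat_eq_iff:
  "p = q \<longleftrightarrow> qRe p = qRe q \<and> qIm1 p = qIm1 q \<and> qIm2 p = qIm2 q \<and> qIm3 p = qIm3 q"
  by (cases p; cases q) simp

instantiation quat :: ab_group_add
begin

definition "0 = Quat 0 0 0 0"

definition "p + q = Quat (qRe p + qRe q) (qIm1 p + qIm1 q) (qIm2 p + qIm2 q) (qIm3 p + qIm3 q)"

definition "- q = Quat (- qRe q) (- qIm1 q) (- qIm2 q) (- qIm3 q)"

definition "p - q = Quat (qRe p - qRe q) (qIm1 p - qIm1 q) (qIm2 p - qIm2 q) (qIm3 p - qIm3 q)"

instance
  by standard (simp_all add: quat_eq_iff zero_quat_def plus_quat_def uminus_quat_def minus_quat_def)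

end

instantiation quat :: real_vector
begin

definition "r *\<^sub>R q = Quat (r * qRe q) (r * qIm1 q) (r * qIm2 q) (r * qIm3 q)"

instance
  by standard (simp_all add: quat_eq_iff plus_quat_def scaleR_quat_def algebra_simps)

end

instantiation quat :: real_inner
begin

definition "p \<bullet> q = qRe p * qRe q + qIm1 p * qIm1 q + qIm2 p * qIm2 q + qIm3 p * qIm3 q"

definition norm_quat :: "quat \<Rightarrow> real" where "norm_quat q = sqrt (q \<bullet> q)"

definition sgn_quat :: "quat \<Rightarrow> quat" where "sgn_quat q = q /\<^sub>R norm q"

definition dist_quat :: "quat \<Rightarrow> quat \<Rightarrow> real" where "dist_quat p q = norm (p - q)"

definition uniformity_quat :: "(quat \<times> quat) filter"
  where "uniformity_quat = (INF e\<in>{0<..}. principal {(p, q). dist p q < e})"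

definition open_quat :: "quat set \<Rightarrow> bool"
  where "open_quat U \<longleftrightarrow> (\<forall>p\<in>U. eventually (\<lambda>(p', q). p' = p \<longrightarrow> q \<in> U) uniformity)"

instance
proof
  fix x :: quat
  have "x \<bullet> x = (qRe x)\<^sup>2 + (qIm1 x)\<^sup>2 + (qIm2 x)\<^sup>2 + (qIm3 x)\<^sup>2"
    by (simp add: inner_quat_def power2_eq_square)
  then show "0 \<le> x \<bullet> x" and "(x \<bullet> x = 0) = (x = 0)"
    by (auto simp: quat_eq_iff zero_quat_def add_nonneg_eq_0_iff)
qed (simp_all add: quat_eq_iff plus_quat_def minus_quat_def scaleR_quat_def inner_quat_def
      norm_quat_def sgn_quat_def dist_quat_def uniformity_quat_def open_quat_def algebra_simps)

end

instantiation quat :: euclidean_space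
begin

definition "Basis = {Quat 1 0 0 0, Quat 0 1 0 0, Quat 0 0 1 0, Quat 0 0 0 1}"

instance
proof
  show "(Basis :: quat set) \<noteq> {}" and "finite (Basis :: quat set)"
    by (simp_all add: Basis_quat_def)
  show "u \<bullet> v = (if u = v then 1 else 0)" if "u \<in> Basis" "v \<in> Basis" for u v :: quat
    using that unfolding Basis_quat_def by (elim insertE emptyE) (simp_all add: inner_quat_def)
  show "(\<forall>u\<in>Basis. x \<bullet> u = 0) = (x = 0)" for x :: quat
    by (cases x) (simp add: Basis_quat_def inner_quat_def zero_quat_def)
qed

end

instantiation quat :: real_normed_div_algebra
begin

definition "1 = Quat 1 0 0 0"

text \<open>Hamilton's relations, with units in the order \<open>1, i, j, k\<close>.\<close>

definition "p * q = Quat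
    (qRe p * qRe q - qIm1 p * qIm1 q - qIm2 p * qIm2 q - qIm3 p * qIm3 q)
    (qRe p * qIm1 q + qIm1 p * qRe q + qIm2 p * qIm3 q - qIm3 p * qIm2 q)
    (qRe p * qIm2 q - qIm1 p * qIm3 q + qIm2 p * qRe q + qIm3 p * qIm1 q)
    (qRe p * qIm3 q + qIm1 p * qIm2 q - qIm2 p * qIm1 q + qIm3 p * qRe q)"

definition qcnj :: "quat \<Rightarrow> quat"
  where "qcnj q = Quat (qRe q) (- qIm1 q) (- qIm2 q) (- qIm3 q)"

definition "inverse q = qcnj q /\<^sub>R (q \<bullet> q)"

definition divide_quat :: "quat \<Rightarrow> quat \<Rightarrow> quat" where "divide_quat p q = p * inverse q"

instance
proof
  fix x y :: quat
  have qq: "qcnj x * x = (x \<bullet> x) *\<^sub>R 1" "x * qcnj x = (x \<bullet> x) *\<^sub>R 1"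
    by (simp_all add: quat_eq_iff times_quat_def qcnj_def inner_quat_def one_quat_def
        scaleR_quat_def)
  have l: "(r *\<^sub>R u) * v = r *\<^sub>R (u * v)" "u * (r *\<^sub>R v) = r *\<^sub>R (u * v)" for r and u v :: quat
    by (simp_all add: quat_eq_iff times_quat_def scaleR_quat_def algebra_simps)
  show "inverse x * x = 1" "x * inverse x = 1" if "x \<noteq> 0"
    using that by (simp_all add: inverse_quat_def l qq)
  have "(x * y) \<bullet> (x * y) = (x \<bullet> x) * (y \<bullet> y)"
    by (simp add: inner_quat_def times_quat_def algebra_simps)
  then show "norm (x * y) = norm x * norm y"
    by (simp add: norm_quat_def real_sqrt_mult)
qed (simp_all add: quat_eq_iff zero_quat_def one_quat_def plus_quat_def times_quat_def
      scaleR_quat_def inverse_quat_def divide_quat_def qcnj_def inner_quat_def algebra_simps)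

end

section \<open>Slice regular functions on the unit ball\<close>

definition imag_units :: "quat set"
  where "imag_units = {q. qRe q = 0 \<and> norm q = 1}"

definition slice_embed :: "quat \<Rightarrow> complex \<Rightarrow> quat"
  where "slice_embed i z = of_real (Re z) + i * of_real (Im z)"

definition slice :: "quat \<Rightarrow> quat set"
  where "slice i = range (slice_embed i)"

definition slice_ball :: "quat \<Rightarrow> quat set"
  where "slice_ball i = ball 0 1 \<inter> slice i"

text \<open>Functions on the unit ball (or on a slice of it) are total functions on \<^typ>\<open>quat\<close> whose
  values elsewhere are irrelevant.\<close>

definition slice_regular :: "(quat \<Rightarrow> quat) set"
  where "slice_regular = {f. f differentiable_on ball 0 1 \<and>
    (\<forall>i\<in>imag_units. \<forall>x y :: real. of_real x + i * of_real y \<in> ball 0 1 \<longrightarrow>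
       vector_derivative (\<lambda>t. f (of_real t + i * of_real y)) (at x)
       + i * vector_derivative (\<lambda>t. f (of_real x + i * of_real t)) (at y) = 0)}"

definition deriv_x0 :: "(quat \<Rightarrow> quat) \<Rightarrow> quat \<Rightarrow> quat"
  where "deriv_x0 f q = vector_derivative (\<lambda>t. f (q + of_real t)) (at 0)"

section \<open>The Besov spaces\<close>

text \<open>The measures on the slice through \<open>i\<close>, transported to the unit disc of \<^typ>\<open>complex\<close> along
  \<^term>\<open>slice_embed i\<close>. In this parametrisation they do not depend on \<open>i\<close>.\<close>

definition disc_area :: "complex measure"
  where "disc_area = density lborel (\<lambda>z. ennreal (indicator (ball 0 1) z / pi))"

definition disc_lambda :: "complex measure"
  where "disc_lambda = density disc_area (\<lambda>z. ennreal (1 / (1 - (norm z)\<^sup>2)\<^sup>2))"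

definition besov :: "real \<Rightarrow> quat \<Rightarrow> (quat \<Rightarrow> quat) set"
  where "besov p i = {f \<in> slice_regular. \<exists>n::nat. real n * p > 1 \<and>
    (\<integral>\<^sup>+ z. ennreal (norm (of_real ((1 - (norm z)\<^sup>2) ^ n)
                * (deriv_x0 ^^ n) f (slice_embed i z)) powr p) \<partial>disc_lambda) < \<infinity>}"

section \<open>Restriction, splitting and extension\<close>

definition slice_restrict :: "quat \<Rightarrow> (quat \<Rightarrow> quat) \<Rightarrow> quat \<Rightarrow> quat"  (\<open>Q\<^bsub>_\<^esub>\<close>)
  where "Q\<^bsub>i\<^esub> f = restrict f (slice_ball i)"

text \<open>For orthogonal imaginary units \<open>i\<close>, \<open>j\<close>, every quaternion is \<open>u + v * j\<close> with unique
  \<open>u\<close>, \<open>v\<close> in the slice through \<open>i\<close>; the components of \<^term>\<open>Q\<^bsub>i\<^esub> f\<close> are taken pointwise.\<close>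

definition split_fst :: "quat \<Rightarrow> quat \<Rightarrow> (quat \<Rightarrow> quat) \<Rightarrow> quat \<Rightarrow> quat"
  where "split_fst i j f z = (THE u. u \<in> slice i \<and> (\<exists>v\<in>slice i. (Q\<^bsub>i\<^esub> f) z = u + v * j))"

definition split_snd :: "quat \<Rightarrow> quat \<Rightarrow> (quat \<Rightarrow> quat) \<Rightarrow> quat \<Rightarrow> quat"
  where "split_snd i j f z = (THE v. v \<in> slice i \<and> (\<exists>u\<in>slice i. (Q\<^bsub>i\<^esub> f) z = u + v * j))"

definition qvec :: "quat \<Rightarrow> quat"
  where "qvec q = Quat 0 (qIm1 q) (qIm2 q) (qIm3 q)"

text \<open>Every \<open>q\<close> is \<open>x + I * y\<close> with \<open>x = qRe q\<close>, \<open>y = norm (qvec q)\<close> and \<open>I = sgn (qvec q)\<close>. For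
  real \<open>q\<close> this makes \<open>I = 0\<close> rather than an imaginary unit, but then \<open>y = 0\<close> and \<open>I\<close> cancels.\<close>

definition slice_extend :: "quat \<Rightarrow> (quat \<Rightarrow> quat) \<Rightarrow> quat \<Rightarrow> quat"  (\<open>P\<^bsub>_\<^esub>\<close>)
  where "P\<^bsub>i\<^esub> g q =
    (let x = of_real (qRe q); y = of_real (norm (qvec q)); I = sgn (qvec q)
     in ((1 + I * i) * g (x - y * i) + (1 - I * i) * g (x + y * i)) /\<^sub>R 2)"

section \<open>Slice regular Moebius transformations\<close>

definition qpowser :: "(nat \<Rightarrow> quat) \<Rightarrow> quat \<Rightarrow> quat"
  where "qpowser c q = (\<Sum>n. q ^ n * c n)"

text \<open>The slice regular product, on coefficient sequences.\<close>

definition star_prod :: "(nat \<Rightarrow> quat) \<Rightarrow> (nat \<Rightarrow> quat) \<Rightarrow> nat \<Rightarrow> quat"  (infixl \<open>\<star>\<close> 70)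
  where "(b \<star> c) n = (\<Sum>k\<le>n. b k * c (n - k))"

definition moebius :: "quat \<Rightarrow> quat \<Rightarrow> quat"
  where "moebius a = qpowser
    ((\<lambda>n. qcnj a ^ n) \<star> (\<lambda>n. if n = 0 then a else if n = 1 then - 1 else 0))"

definition slice_comp_moebius :: "quat \<Rightarrow> quat \<Rightarrow> (quat \<Rightarrow> quat) \<Rightarrow> quat \<Rightarrow> quat \<Rightarrow> quat"
  where "slice_comp_moebius i j f a =
    (\<lambda>q. P\<^bsub>i\<^esub> (split_fst i j f \<circ> Q\<^bsub>i\<^esub> (moebius a)) q
       + P\<^bsub>i\<^esub> (split_snd i j f \<circ> Q\<^bsub>i\<^esub> (moebius a)) q * j)"

end

(* Through the splitting f = f1 + f2 j on the slice of i, iterated x0-derivatives become complex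
   derivatives, so the claim concerns a holomorphic h on the unit disc, and the order of
   differentiation for the composition with T may be chosen anew.

   Suppose (1 - |w|^2)^n h^(n) is in L^p(lambda), and take m >= n with (m - n) p >= 2. By the chain
   rule (h o T)^(m) is a combination, with bounded coefficients, of the functions h^(k) o T, k <= m.
   For k <= n a pointwise bound |h^(k)(w)| <= C (1 - |w|)^(-n) is enough: the surplus weight
   (1 - |z|^2)^((m - n) p) makes the integral converge. For k >= n, Cauchy's inequality and a
   sub-mean value inequality for |.|^p bound ((1 - |w|^2)^k |h^(k)(w)|)^p by the integral of
   ((1 - |.|^2)^n |h^(n)|)^p over the disc of radius (1 - |w|) / 2 about w. Putting w = T z and
   exchanging the order of integration, it remains that the z for which a given point lies in this
   disc form a set of bounded lambda-measure, which replaces a change of variables. *)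

theory Submission
  imports Defs "HOL-Complex_Analysis.Complex_Analysis"
begin

section \<open>Rotation invariance of planar Lebesgue measure\<close>

text \<open>Membership in \<open>besov\<close> asks for one admissible order only, so raising
  \<open>n\<close> to a larger \<open>m\<close> is harmless, and it buys the surplus that makes the
  low-order terms of the chain rule integrable: (m - n) p >= 2 compensates the factor (1 -
  |z|^2)^(-2) in \<open>disc_lambda\<close>. All constants may depend on \<open>a\<close>, so crude
  distortion bounds for T suffice: it is Lipschitz, it is its own inverse, and it changes 1 - |z|^2
  by a bounded factor. Two obstacles shape the rest. Small p rules out convexity, so the sub-mean
  value inequality for |h|^p is derived from the one for integer powers of h, and this from Cauchy's
  formula and the rotation invariance of Lebesgue measure. Moreover, the composition must be
  differentiable on the whole quaternionic ball, while the unit \<open>sgn (qvec q)\<close> has no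
  limit at real points; there the extension is compared with the extension of a
  linearisation.\<close>

lemma lborel_complex_eq:
  "(lborel :: complex measure) = distr (lborel \<Otimes>\<^sub>M lborel) borel (\<lambda>(x, y). Complex x y)"
proof (rule lborel_eqI)
  have m: "(\<lambda>(x, y). Complex x y) \<in> borel_measurable (lborel \<Otimes>\<^sub>M lborel)"
    unfolding Complex_eq by measurable
  show "emeasure (distr (lborel \<Otimes>\<^sub>M lborel) borel (\<lambda>(x, y). Complex x y)) (box l u)
      = (\<Prod>b\<in>Basis. (u - l) \<bullet> b)"
    if "\<And>b. b \<in> Basis \<Longrightarrow> l \<bullet> b \<le> u \<bullet> b" for l u :: complex
  proof -
    have le: "Re l \<le> Re u" "Im l \<le> Im u"
      using that[of 1] that[of \<i>] by (simp_all add: Basis_complex_def)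
    have "(\<lambda>(x, y). Complex x y) -` box l u = {Re l<..<Re u} \<times> {Im l<..<Im u}"
      by (auto simp: in_box_complex_iff)
    then show ?thesis
      using le
      by (simp add: emeasure_distr m space_pair_measure lborel.emeasure_pair_measure_Times
          Basis_complex_def ennreal_mult)
  qed
qed simp

text \<open>Both orders of integration are recorded: a horizontal shear needs the inner integral
  along x, a vertical one the inner integral along y.\<close>

lemma nn_integral_complex_eq:
  fixes F :: "complex \<Rightarrow> ennreal"
  assumes [measurable]: "F \<in> borel_measurable borel"
  shows "(\<integral>\<^sup>+z. F z \<partial>lborel) = (\<integral>\<^sup>+y. \<integral>\<^sup>+x. F (Complex x y) \<partial>lborel \<partial>lborel)"
    and "(\<integral>\<^sup>+z. F z \<partial>lborel) = (\<integral>\<^sup>+x. \<integral>\<^sup>+y. F (Complex x y) \<partial>lborel \<partial>lborel)"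
proof -
  have m [measurable]: "(\<lambda>(x, y). Complex x y) \<in> borel_measurable (lborel \<Otimes>\<^sub>M lborel)"
    unfolding Complex_eq by measurable
  have Fm [measurable]: "(\<lambda>z. F (case z of (x, y) \<Rightarrow> Complex x y)) \<in> borel_measurable (lborel \<Otimes>\<^sub>M lborel)"
    by measurable
  have *: "(\<integral>\<^sup>+z. F z \<partial>lborel) = (\<integral>\<^sup>+z. F (case z of (x, y) \<Rightarrow> Complex x y) \<partial>(lborel \<Otimes>\<^sub>M lborel))"
    by (subst lborel_complex_eq) (simp add: nn_integral_distr)
  show "(\<integral>\<^sup>+z. F z \<partial>lborel) = (\<integral>\<^sup>+y. \<integral>\<^sup>+x. F (Complex x y) \<partial>lborel \<partial>lborel)"
    using lborel_pair.nn_integral_snd[OF Fm] * by simp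
  show "(\<integral>\<^sup>+z. F z \<partial>lborel) = (\<integral>\<^sup>+x. \<integral>\<^sup>+y. F (Complex x y) \<partial>lborel \<partial>lborel)"
    using lborel.nn_integral_fst[OF Fm] * by simp
qed

lemma nn_integral_shift:
  fixes F :: "'a::euclidean_space \<Rightarrow> ennreal"
  assumes [measurable]: "F \<in> borel_measurable borel"
  shows "(\<integral>\<^sup>+x. F (t + x) \<partial>lborel) = (\<integral>\<^sup>+x. F x \<partial>lborel)"
  by (subst (2) lborel_affine[of 1 t]) (simp_all add: density_1 nn_integral_distr)

text \<open>For a fixed value of the unchanged coordinate a shear is a translation of a line, so
  Tonelli and \<open>nn_integral_shift\<close> suffice.\<close>

lemma nn_integral_shear:
  fixes F :: "complex \<Rightarrow> ennreal"
  assumes [measurable]: "F \<in> borel_measurable borel"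
  shows "(\<integral>\<^sup>+z. F (Complex (Re z + s * Im z) (Im z)) \<partial>lborel) = (\<integral>\<^sup>+z. F z \<partial>lborel)"
    and "(\<integral>\<^sup>+z. F (Complex (Re z) (Im z + s * Re z)) \<partial>lborel) = (\<integral>\<^sup>+z. F z \<partial>lborel)"
proof -
  have c1: "(\<lambda>x. F (Complex x y)) \<in> borel_measurable borel" for y
    unfolding Complex_eq by measurable
  have c2: "(\<lambda>y. F (Complex x y)) \<in> borel_measurable borel" for x
    unfolding Complex_eq by measurable
  have m1: "(\<lambda>z. F (Complex (Re z + s * Im z) (Im z))) \<in> borel_measurable borel"
    unfolding Complex_eq by measurable
  have m2: "(\<lambda>z. F (Complex (Re z) (Im z + s * Re z))) \<in> borel_measurable borel"
    unfolding Complex_eq by measurable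
  show "(\<integral>\<^sup>+z. F (Complex (Re z + s * Im z) (Im z)) \<partial>lborel) = (\<integral>\<^sup>+z. F z \<partial>lborel)"
    using nn_integral_shift[OF c1, of "s * y" y for y]
    by (simp add: nn_integral_complex_eq(1)[OF m1] nn_integral_complex_eq(1)[OF assms] add.commute)
  show "(\<integral>\<^sup>+z. F (Complex (Re z) (Im z + s * Re z)) \<partial>lborel) = (\<integral>\<^sup>+z. F z \<partial>lborel)"
    using nn_integral_shift[OF c2, of x "s * x" for x]
    by (simp add: nn_integral_complex_eq(2)[OF m2] nn_integral_complex_eq(2)[OF assms] add.commute)
qed

text \<open>A rotation other than \<open>z \<mapsto> - z\<close> is a product of three shears.\<close>

lemma nn_integral_rotate_aux:
  fixes F :: "complex \<Rightarrow> ennreal"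
  assumes F [measurable]: "F \<in> borel_measurable borel" and c: "norm c = 1" "c \<noteq> -1"
  shows "(\<integral>\<^sup>+z. F (c * z) \<partial>lborel) = (\<integral>\<^sup>+z. F z \<partial>lborel)"
proof -
  have n: "(Re c)\<^sup>2 + (Im c)\<^sup>2 = 1"
    using c(1) by (simp add: cmod_def)
  have nz: "1 + Re c \<noteq> 0"
  proof
    assume "1 + Re c = 0"
    then have "Re c = -1" by simp
    with n have "Im c = 0" by simp
    with \<open>Re c = -1\<close> c(2) show False by (simp add: complex_eq_iff)
  qed
  \<comment> \<open>For c = e^(it) this is -tan(t/2), which is infinite exactly at the excluded half
    turn; the middle shear \<open>?B\<close> has slope sin t.\<close>
  define s where "s = - Im c / (1 + Re c)"
  have s1: "1 + s * Im c = Re c" 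
    using n nz by (simp add: s_def field_simps power2_eq_square)
  have "s * (1 + Re c) = - Im c"
    using nz by (simp add: s_def)
  then have s3: "s * (1 + s * Im c) + s = - Im c"
    unfolding s1 by (simp add: algebra_simps)
  let ?A = "\<lambda>z. Complex (Re z + s * Im z) (Im z)"
  let ?B = "\<lambda>z. Complex (Re z) (Im z + Im c * Re z)"
  have eq: "c * z = ?A (?B (?A z))" for z
  proof (rule complex_eqI)
    show "Im (c * z) = Im (?A (?B (?A z)))"
      using s1 by (simp add: algebra_simps) (metis distrib_right mult.assoc mult.commute mult_1)
    have "Re (?A (?B (?A z))) = (1 + s * Im c) * Re z + (s * (1 + s * Im c) + s) * Im z"
      by (simp add: algebra_simps)
    then show "Re (c * z) = Re (?A (?B (?A z)))"
      unfolding s1 s3[unfolded s1] by simp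
  qed
  have m1: "(\<lambda>z. F (?A z)) \<in> borel_measurable borel"
    unfolding Complex_eq by measurable
  have m2: "(\<lambda>z. F (?A (?B z))) \<in> borel_measurable borel"
    unfolding Complex_eq by measurable
  show ?thesis
    unfolding eq
    using nn_integral_shear(1)[OF m2, of s] nn_integral_shear(2)[OF m1, of "Im c"] nn_integral_shear(1)[OF F, of s]
    by simp
qed

text \<open>The principal square root of \<open>c\<close> is never \<open>-1\<close>, so rotating
  twice by it also covers the half turn.\<close>

lemma nn_integral_rotate:
  fixes F :: "complex \<Rightarrow> ennreal"
  assumes F [measurable]: "F \<in> borel_measurable borel" and c: "norm c = 1"
  shows "(\<integral>\<^sup>+z. F (c * z) \<partial>lborel) = (\<integral>\<^sup>+z. F z \<partial>lborel)"
proof -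
  have d: "norm (csqrt c) = 1" "csqrt c \<noteq> -1"
    using c csqrt_principal[of c] by (auto simp: norm_csqrt simp del: csqrt.sel)
  have "(\<integral>\<^sup>+z. F (c * z) \<partial>lborel) = (\<integral>\<^sup>+z. F (csqrt c * (csqrt c * z)) \<partial>lborel)"
    by (simp flip: mult.assoc power2_eq_square)
  also have "\<dots> = (\<integral>\<^sup>+z. F z \<partial>lborel)"
    using nn_integral_rotate_aux[of "\<lambda>z. F (csqrt c * z)", OF _ d] nn_integral_rotate_aux[OF F d] by simp
  finally show ?thesis .
qed

section \<open>Sub-mean value inequalities\<close>

text \<open>Cauchy's integral formula at the centre. The mean is written as a nonnegative integral
  so that Tonelli applies once the bound is integrated over the disc.\<close>

lemma norm_le_circle_mean_aux:
  assumes h: "h holomorphic_on ball 0 r" and s: "0 < s" "s < r"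
  shows "ennreal (2 * pi * norm (h 0)) \<le> (\<integral>\<^sup>+t\<in>{0..2*pi}. norm (h (exp (\<i> * of_real t) * of_real s)) \<partial>lborel)"
proof -
  have cb: "cball 0 s \<subseteq> ball 0 r" using s by auto
  have "h holomorphic_on ball 0 s" "continuous_on (cball 0 s) h"
    using h cb s by (auto intro: holomorphic_on_subset continuous_on_subset holomorphic_on_imp_continuous_on)
  then have "((\<lambda>u. h u / (u - 0)) has_contour_integral (2 * of_real pi * \<i> * h 0)) (circlepath 0 s)"
    using s by (intro Cauchy_integral_circlepath) auto
  then have "((\<lambda>t. h (s * exp (\<i> * of_real t)) / (s * exp (\<i> * of_real t)) * s * \<i> * exp (\<i> * of_real t)) has_integral (2 * of_real pi * \<i> * h 0)) {0..2*pi}"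
    unfolding circlepath_def
    by (subst (asm) has_contour_integral_part_circlepath_iff) (auto simp: cis_conv_exp)
  moreover have "h (s * exp (\<i> * of_real t)) / (s * exp (\<i> * of_real t)) * s * \<i> * exp (\<i> * of_real t) = \<i> * h (s * exp (\<i> * of_real t))" for t
    using s by simp
  ultimately have I: "((\<lambda>t. \<i> * h (s * exp (\<i> * of_real t))) has_integral (2 * of_real pi * \<i> * h 0)) {0..2*pi}"
    by (simp only:)
  have cont: "continuous_on A (\<lambda>t. h (exp (\<i> * of_real t) * of_real s))" for A
    by (rule continuous_on_compose2[OF holomorphic_on_imp_continuous_on[OF h]])
       (use s in \<open>auto intro!: continuous_intros simp: norm_mult\<close>)
  have "2 * pi * norm (h 0) = norm (2 * of_real pi * \<i> * h 0)"
    by (simp add: norm_mult)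
  also have "\<dots> = norm (integral {0..2*pi} (\<lambda>t. \<i> * h (s * exp (\<i> * of_real t))))"
    by (simp only: integral_unique[OF I])
  also have "\<dots> \<le> integral {0..2*pi} (\<lambda>t. norm (h (exp (\<i> * of_real t) * of_real s)))"
    by (intro integral_norm_bound_integral integrable_continuous_real)
       (auto simp: norm_mult mult.commute[of "of_real s"] integrable_on_def intro!: continuous_intros cont)
  finally have le: "2 * pi * norm (h 0) \<le> integral {0..2*pi} (\<lambda>t. norm (h (exp (\<i> * of_real t) * of_real s)))" .
  have "ennreal (integral {0..2*pi} (\<lambda>t. norm (h (exp (\<i> * of_real t) * of_real s))))
      = (\<integral>\<^sup>+t\<in>{0..2*pi}. norm (h (exp (\<i> * of_real t) * of_real s)) \<partial>lborel)"
    by (rule nn_integral_has_integral_lebesgue'[symmetric])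
       (auto intro!: integrable_integral integrable_continuous_real continuous_intros cont)
  then show ?thesis
    using ennreal_leI[OF le] by simp
qed

text \<open>Precomposing \<open>h\<close> with the rotation by \<open>u = z / norm z\<close> reduces
  this to a positive real starting point. Admitting every \<open>z\<close> of the disc, the centre
  included, allows the bound to be integrated over \<open>z\<close>.\<close>

lemma norm_le_circle_mean:
  assumes h: "h holomorphic_on ball 0 r" and z: "z \<in> ball 0 r"
  shows "ennreal (2 * pi * norm (h 0)) \<le> (\<integral>\<^sup>+t\<in>{0..2*pi}. norm (h (exp (\<i> * of_real t) * z)) \<partial>lborel)"
proof (cases "z = 0")
  case True
  then show ?thesis
    by (simp add: nn_integral_cmult_indicator ennreal_mult' mult.commute)
next
  case False
  define u where "u = z / of_real (norm z)"
  have "norm u = 1" using False by (simp add: u_def norm_divide)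
  then have "(\<lambda>w. h (u * w)) holomorphic_on ball 0 r"
    by (intro holomorphic_on_compose_gen[OF _ h, unfolded o_def] holomorphic_intros)
       (auto simp: norm_mult)
  then have "ennreal (2 * pi * norm (h (u * 0))) \<le> (\<integral>\<^sup>+t\<in>{0..2*pi}. norm (h (u * (exp (\<i> * of_real t) * of_real (norm z)))) \<partial>lborel)"
    using z False by (intro norm_le_circle_mean_aux) auto
  moreover have "u * (w * of_real (norm z)) = w * z" for w
    using False by (simp add: u_def)
  ultimately show ?thesis
    by (simp only: mult_zero_right)
qed

text \<open>Rotation invariance takes the place of polar coordinates: the circle bound is integrated
  over all \<open>z\<close> in the disc, the integrals are exchanged, and for each angle the
  integral over \<open>z\<close> is that of \<open>F\<close> itself. The length
  \<open>2 * pi\<close> of the angular interval then cancels.\<close>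

lemma submean_area_aux:
  assumes h: "h holomorphic_on ball 0 r" and r: "r > 0"
  shows "ennreal (pi * r\<^sup>2 * norm (h 0)) \<le> (\<integral>\<^sup>+z\<in>ball 0 r. norm (h z) \<partial>lborel)"
proof -
  define F where "F z = ennreal (norm (h z)) * indicator (ball 0 r) z" for z
  have [measurable]: "F \<in> borel_measurable borel"
  proof -
    have "(\<lambda>z. indicator (ball 0 r) z *\<^sub>R norm (h z)) \<in> borel_measurable borel"
      by (intro borel_measurable_continuous_on_indicator continuous_intros
          holomorphic_on_imp_continuous_on[OF h]) auto
    then have "(\<lambda>z. ennreal (indicator (ball 0 r) z *\<^sub>R norm (h z))) \<in> borel_measurable borel"
      by simp
    also have "(\<lambda>z. ennreal (indicator (ball 0 r) z *\<^sub>R norm (h z))) = F"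
      by (auto simp: F_def indicator_def)
    finally show ?thesis .
  qed
  have "ennreal (2 * pi) * ennreal (pi * r\<^sup>2 * norm (h 0))
      = ennreal (2 * pi * norm (h 0)) * emeasure lborel (ball 0 r :: complex set)"
    using r by (simp add: emeasure_ball unit_ball_vol_2 ennreal_mult''[symmetric] ennreal_mult'[symmetric] mult_ac)
  also have "\<dots> = (\<integral>\<^sup>+z. ennreal (2 * pi * norm (h 0)) * indicator (ball 0 r) z \<partial>(lborel::complex measure))"
    by (simp add: nn_integral_cmult_indicator)
  also have "\<dots> \<le> (\<integral>\<^sup>+z. (\<integral>\<^sup>+t. F (exp (\<i> * of_real t) * z) * indicator {0..2*pi} t \<partial>lborel) \<partial>lborel)"
  proof (rule nn_integral_mono)
    fix z :: complex
    have "ennreal (2 * pi * norm (h 0)) \<le> (\<integral>\<^sup>+t. F (exp (\<i> * of_real t) * z) * indicator {0..2*pi} t \<partial>lborel)" if z: "z \<in> ball 0 r"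
    proof -
      have "F (exp (\<i> * of_real t) * z) = norm (h (exp (\<i> * of_real t) * z))" for t
        using z by (simp add: F_def norm_mult)
      then show ?thesis using norm_le_circle_mean[OF h z] by simp
    qed
    then show "ennreal (2 * pi * norm (h 0)) * indicator (ball 0 r) z \<le> (\<integral>\<^sup>+t. F (exp (\<i> * of_real t) * z) * indicator {0..2*pi} t \<partial>lborel)"
      by (cases "z \<in> ball 0 r") auto
  qed
  also have "\<dots> = (\<integral>\<^sup>+t. (\<integral>\<^sup>+z. F (exp (\<i> * of_real t) * z) * indicator {0..2*pi} t \<partial>lborel) \<partial>lborel)"
    by (rule lborel_pair.Fubini') simp
  also have "\<dots> = (\<integral>\<^sup>+t. (\<integral>\<^sup>+z. F z \<partial>lborel) * indicator {0..2*pi} t \<partial>lborel)"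
    by (simp add: nn_integral_multc nn_integral_rotate)
  also have "\<dots> = ennreal (2 * pi) * (\<integral>\<^sup>+z. F z \<partial>lborel)"
    by (simp add: nn_integral_cmult_indicator mult.commute)
  finally have "ennreal (2 * pi) * ennreal (pi * r\<^sup>2 * norm (h 0)) \<le> ennreal (2 * pi) * (\<integral>\<^sup>+z. F z \<partial>lborel)" .
  then show ?thesis
    by (subst (asm) ennreal_mult_le_mult_iff) (auto simp: F_def[abs_def])
qed

lemma submean_area:
  assumes h: "h holomorphic_on ball z r" and r: "r > 0"
  shows "ennreal (pi * r\<^sup>2 * norm (h z)) \<le> (\<integral>\<^sup>+w\<in>ball z r. norm (h w) \<partial>lborel)"
proof -
  have "(\<lambda>w. h (z + w)) holomorphic_on ball 0 r"
    by (intro holomorphic_on_compose_gen[OF _ h, unfolded o_def] holomorphic_intros)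
       (auto simp: dist_norm)
  from submean_area_aux[OF this r]
  have le: "ennreal (pi * r\<^sup>2 * norm (h z)) \<le> (\<integral>\<^sup>+w. ennreal (norm (h (z + w))) * indicator (ball 0 r) w \<partial>lborel)"
    by simp
  have ind: "indicator (ball 0 r) w = (indicator (ball z r) (z + w) :: ennreal)" for w
    by (simp add: indicator_def dist_norm)
  have "(\<lambda>z'. indicator (ball z r) z' *\<^sub>R norm (h z')) \<in> borel_measurable borel"
    by (intro borel_measurable_continuous_on_indicator continuous_intros
        holomorphic_on_imp_continuous_on[OF h]) auto
  then have "(\<lambda>w. ennreal (indicator (ball z r) w *\<^sub>R norm (h w))) \<in> borel_measurable borel"
    by simp
  also have "(\<lambda>w. ennreal (indicator (ball z r) w *\<^sub>R norm (h w))) = (\<lambda>w. ennreal (norm (h w)) * indicator (ball z r) w)"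
    by (auto simp: indicator_def)
  finally show ?thesis
    using le nn_integral_shift[of "\<lambda>w. ennreal (norm (h w)) * indicator (ball z r) w" z] unfolding ind by simp
qed

lemma powr_norm_measurable:
  fixes h :: "'a::euclidean_space \<Rightarrow> real"
  assumes "continuous_on A h" "A \<in> sets borel" "\<And>x. x \<in> A \<Longrightarrow> h x \<ge> 0" "p > 0"
  shows "(\<lambda>x. ennreal (h x powr p) * indicator A x) \<in> borel_measurable borel"
proof -
  have "(\<lambda>x. indicator A x *\<^sub>R (h x powr p)) \<in> borel_measurable borel"
    using assms by (intro borel_measurable_continuous_on_indicator continuous_on_powr') auto
  then have "(\<lambda>x. ennreal (indicator A x *\<^sub>R (h x powr p))) \<in> borel_measurable borel"
    by simp
  also have "(\<lambda>x. ennreal (indicator A x *\<^sub>R (h x powr p))) = (\<lambda>x. ennreal (h x powr p) * indicator A x)"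
    by (auto simp: indicator_def)
  finally show ?thesis .
qed

text \<open>For small \<open>p\<close> the function \<open>norm h powr p\<close> has no mean value inequality from convexity;
  instead the inequality for \<open>h ^ m\<close> is applied at a point maximising
  \<open>(R - dist w z) powr (2 / p) * norm (h w)\<close>, where the surplus power \<open>m - p\<close> can be absorbed.\<close>

lemma submean_powr:
  assumes p: "p > (0::real)"
  obtains C where "C > 0" "\<And>h z r. h holomorphic_on ball z r \<Longrightarrow> r > 0 \<Longrightarrow>
    ennreal (r\<^sup>2 * norm (h z) powr p) \<le> ennreal C * (\<integral>\<^sup>+w\<in>ball z r. norm (h w) powr p \<partial>lborel)"
proof -
  \<comment> \<open>An integer exponent at least \<open>p\<close>: \<open>h ^ m\<close> is again
    holomorphic, and \<open>m - p\<close> is nonnegative, so \<open>x powr (m - p)\<close> is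
    monotone.\<close>
  define m where "m = nat \<lceil>p\<rceil>"
  have m: "m > 0" "p \<le> real m"
    using p by (auto simp: m_def)
  \<comment> \<open>The factor 4 is (r / R)^2, \<open>2 powr (2 * m / p)\<close> is the m-th power
    of \<open>M / norm (h w0)\<close>, and \<open>pi\<close> comes from the area of the disc about
    \<open>w0\<close>.\<close>
  define C where "C = 4 * 2 powr (2 * m / p) / pi"
  show thesis
  proof
    show "C > 0" by (simp add: C_def)
    fix h and z :: complex and r :: real
    assume h: "h holomorphic_on ball z r" and r: "r > 0"
    \<comment> \<open>Halving the radius gives a closed disc on which \<open>h\<close> is
      continuous, so that the maximum below is attained.\<close>
    define R where "R = r / 2"
    have R: "0 < R" "R < r" using r by (auto simp: R_def)
    define J where "J = (\<integral>\<^sup>+w\<in>ball z r. norm (h w) powr p \<partial>lborel)"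
    show "ennreal (r\<^sup>2 * norm (h z) powr p) \<le> ennreal C * J"
    proof (cases "J = \<infinity> \<or> h z = 0")
      case True
      then show ?thesis using \<open>C > 0\<close> by (auto simp: ennreal_mult_top)
    next
      case False
      then obtain J' where J': "J' \<ge> 0" "J = ennreal J'" 
        by (cases J) auto
      have cont: "continuous_on (cball z R) h"
        using R by (intro continuous_on_subset[OF holomorphic_on_imp_continuous_on[OF h]]) auto
      have "continuous_on (cball z R) (\<lambda>w. (R - dist w z) powr (2 / p) * norm (h w))"
        using p by (intro continuous_intros cont continuous_on_powr') (auto simp: dist_commute)
      then obtain w0 where w0: "w0 \<in> cball z R" and
        max: "\<And>w. w \<in> cball z R \<Longrightarrow> (R - dist w z) powr (2 / p) * norm (h w) \<le> (R - dist w0 z) powr (2 / p) * norm (h w0)"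
        using continuous_attains_sup[OF compact_cball, of z R] R by force
      \<comment> \<open>Half of the distance from \<open>w0\<close> to the circle of radius
        \<open>R\<close>: on \<open>ball w0 d\<close> the base \<open>R - dist w z\<close> is at
        least half its value at \<open>w0\<close>, so maximality gives
        \<open>norm (h w) \<le> M\<close>.\<close>
      define d where "d = (R - dist w0 z) / 2"
      have d2: "2 * d = R - dist w0 z" by (simp add: d_def)
      have d0: "d \<ge> 0" using w0 by (simp add: d_def dist_commute)
      have maxz: "R powr (2 / p) * norm (h z) \<le> (2 * d) powr (2 / p) * norm (h w0)"
        using max[of z] R unfolding d2 by simp
      have "0 < R powr (2 / p) * norm (h z)"
        using False R by simp
      then have "0 < (2 * d) powr (2 / p) * norm (h w0)"
        using maxz by linarith
      then have "d \<noteq> 0" "h w0 \<noteq> 0" by auto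
      then have pos: "d > 0" "norm (h w0) > 0"
        using d0 by auto
      define M where "M = 2 powr (2 / p) * norm (h w0)"
      have M: "M > 0" using pos by (simp add: M_def)
      have sub: "ball w0 d \<subseteq> ball z R"
      proof
        fix w assume "w \<in> ball w0 d"
        then show "w \<in> ball z R"
          using dist_triangle[of z w w0] pos by (auto simp: d_def dist_commute field_simps)
      qed
      have le_M: "norm (h w) \<le> M" if w: "w \<in> ball w0 d" for w
      proof -
        have "d \<le> R - dist w z"
          using dist_triangle[of w z w0] w by (auto simp: d_def dist_commute field_simps)
        then have "d powr (2 / p) * norm (h w) \<le> (R - dist w z) powr (2 / p) * norm (h w)"
          using pos p by (intro mult_right_mono powr_mono2) auto
        also have "\<dots> \<le> (2 * d) powr (2 / p) * norm (h w0)"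
          using max[of w] w sub unfolding d2 by auto
        also have "\<dots> = d powr (2 / p) * M"
          using pos by (simp add: powr_mult M_def)
        finally show ?thesis using pos by simp
      qed
      have "(\<lambda>w. h w ^ m) holomorphic_on ball w0 d"
        using sub R by (intro holomorphic_intros holomorphic_on_subset[OF h]) auto
      from submean_area[OF this pos(1)]
      have "ennreal (pi * d\<^sup>2 * norm (h w0) ^ m) \<le> (\<integral>\<^sup>+w\<in>ball w0 d. norm (h w) ^ m \<partial>lborel)"
        by (simp add: norm_power)
      also have "\<dots> \<le> (\<integral>\<^sup>+w. ennreal (M powr (m - p)) * (ennreal (norm (h w) powr p) * indicator (ball z r) w) \<partial>lborel)"
      proof (rule nn_integral_mono)
        fix w
        have "norm (h w) ^ m \<le> M powr (m - p) * norm (h w) powr p" if "w \<in> ball w0 d"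
        proof (cases "h w = 0")
          case False
          then have "norm (h w) ^ m = norm (h w) powr (m - p) * norm (h w) powr p"
            by (simp flip: powr_add powr_realpow)
          also have "\<dots> \<le> M powr (m - p) * norm (h w) powr p"
            using le_M[OF that] m by (intro mult_right_mono powr_mono2) auto
          finally show ?thesis .
        qed (use m in \<open>auto simp: zero_power\<close>)
        then show "ennreal (norm (h w) ^ m) * indicator (ball w0 d) w
            \<le> ennreal (M powr (m - p)) * (ennreal (norm (h w) powr p) * indicator (ball z r) w)"
          using sub R by (auto simp: indicator_def ennreal_mult'[symmetric] intro!: ennreal_leI)
      qed
      also have "\<dots> = ennreal (M powr (m - p)) * J"
      proof -
        have "(\<lambda>w. ennreal (norm (h w) powr p) * indicator (ball z r) w) \<in> borel_measurable borel"
          using p by (intro powr_norm_measurable continuous_intros holomorphic_on_imp_continuous_on[OF h]) auto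
        then show ?thesis
          unfolding J_def by (subst nn_integral_cmult) simp_all
      qed
      finally have "pi * d\<^sup>2 * norm (h w0) ^ m \<le> M powr (m - p) * J'"
        using J' by (simp add: ennreal_mult'[symmetric] ennreal_le_iff)
      moreover have "norm (h w0) ^ m * 2 powr (2 * m / p) = M powr p * M powr (m - p)"
      proof -
        have "M powr p * M powr (m - p) = M ^ m"
          using M by (simp add: powr_add[symmetric] powr_realpow)
        also have "\<dots> = norm (h w0) ^ m * 2 powr (2 * m / p)"
          by (simp add: M_def power_mult_distrib powr_power mult.commute)
        finally show ?thesis by simp
      qed
      ultimately have "pi * d\<^sup>2 * (M powr p * M powr (m - p)) \<le> (M powr (m - p) * J') * 2 powr (2 * m / p)"
        by (metis (no_types, opaque_lifting) mult.assoc mult_right_mono powr_ge_zero)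
      then have "M powr (m - p) * (pi * d\<^sup>2 * M powr p) \<le> M powr (m - p) * (J' * 2 powr (2 * m / p))"
        by (simp add: mult_ac)
      then have A: "pi * d\<^sup>2 * M powr p \<le> J' * 2 powr (2 * m / p)"
        using M by simp
      \<comment> \<open>The weight exponent \<open>2 / p\<close> is chosen for this step: after
        taking the power \<open>p\<close> the weight is quadratic and matches the area factor
        \<open>d\<^sup>2\<close>.\<close>
      have "(R powr (2 / p) * norm (h z)) powr p \<le> ((2 * d) powr (2 / p) * norm (h w0)) powr p"
        using maxz p by (intro powr_mono2) auto
      then have "R\<^sup>2 * norm (h z) powr p \<le> 4 * d\<^sup>2 * norm (h w0) powr p"
        using p R pos by (simp add: powr_mult powr_powr power_mult_distrib)
      also have "M powr p = 4 * norm (h w0) powr p"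
        using p pos by (simp add: M_def powr_mult powr_powr)
      then have "4 * d\<^sup>2 * norm (h w0) powr p = d\<^sup>2 * M powr p"
        by simp
      also have "\<dots> \<le> J' * 2 powr (2 * m / p) / pi"
        using A by (simp add: field_simps)
      finally have "r\<^sup>2 * norm (h z) powr p \<le> C * J'"
        unfolding C_def R_def using J'(1) by (simp add: field_simps power2_eq_square)
      then show ?thesis
        using J' \<open>C > 0\<close> by (simp add: ennreal_mult'[symmetric] ennreal_leI)
    qed
  qed
qed

text \<open>Discs of radius \<open>r / 2\<close> about the points of the circle of radius
  \<open>r / 2\<close> stay inside \<open>ball z r\<close>, so \<open>submean_powr\<close> bounds
  \<open>h\<close> on that circle by the full integral; Cauchy's inequality carries the bound to the
  derivative at the centre.\<close>

lemma submean_powr_deriv: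
  assumes p: "p > (0::real)"
  obtains C where "C > 0" "\<And>h z r. h holomorphic_on ball z r \<Longrightarrow> r > 0 \<Longrightarrow>
    ennreal (r\<^sup>2 * (r ^ l * norm ((deriv ^^ l) h z)) powr p)
      \<le> ennreal C * (\<integral>\<^sup>+w\<in>ball z r. norm (h w) powr p \<partial>lborel)"
proof -
  obtain C0 where C0: "C0 > 0" "\<And>h z r. h holomorphic_on ball z r \<Longrightarrow> r > 0 \<Longrightarrow>
    ennreal (r\<^sup>2 * norm (h z) powr p) \<le> ennreal C0 * (\<integral>\<^sup>+w\<in>ball z r. norm (h w) powr p \<partial>lborel)"
    using submean_powr[OF p] by blast
  \<comment> \<open>\<open>fact l * 2 ^ l\<close> is Cauchy's constant for radius
    \<open>r / 2\<close>; the 4 undoes the square of the halved radius.\<close>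
  define C where "C = (fact l * 2 ^ l) powr p * (4 * C0)"
  show thesis
  proof
    show "C > 0" using C0 by (simp add: C_def)
    fix h and z :: complex and r :: real
    assume h: "h holomorphic_on ball z r" and r: "r > 0"
    define J where "J = (\<integral>\<^sup>+w\<in>ball z r. norm (h w) powr p \<partial>lborel)"
    show "ennreal (r\<^sup>2 * (r ^ l * norm ((deriv ^^ l) h z)) powr p) \<le> ennreal C * J"
    proof (cases "J = \<infinity>")
      case True
      then show ?thesis using \<open>C > 0\<close> by (auto simp: ennreal_mult_top)
    next
      case False
      then obtain J' where J': "J' \<ge> 0" "J = ennreal J'" 
        by (cases J) auto
      define B where "B = (4 * C0 * J' / r\<^sup>2) powr (1 / p)"
      have "norm (h w) \<le> B" if w: "norm (z - w) = r / 2" for w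
      proof -
        have sub: "ball w (r / 2) \<subseteq> ball z r"
        proof
          fix v assume "v \<in> ball w (r / 2)"
          then show "v \<in> ball z r"
            using dist_triangle[of z v w] w by (auto simp: dist_norm)
        qed
        have "ennreal ((r / 2)\<^sup>2 * norm (h w) powr p) \<le> ennreal C0 * (\<integral>\<^sup>+u\<in>ball w (r / 2). norm (h u) powr p \<partial>lborel)"
          using sub r by (intro C0 holomorphic_on_subset[OF h]) auto
        also have "\<dots> \<le> ennreal C0 * J"
          unfolding J_def using sub by (intro mult_left_mono nn_integral_mono) (auto simp: indicator_def)
        also have "\<dots> = ennreal (C0 * J')"
          using J' C0 by (simp add: ennreal_mult')
        finally have "(r / 2)\<^sup>2 * norm (h w) powr p \<le> C0 * J'"
          using J' C0 by (simp add: ennreal_le_iff)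
        then have "norm (h w) powr p \<le> 4 * C0 * J' / r\<^sup>2"
          using r by (simp add: field_simps)
        then have "(norm (h w) powr p) powr (1 / p) \<le> B"
          unfolding B_def using p by (intro powr_mono2) auto
        then show ?thesis using p by (simp add: powr_powr)
      qed
      then have "norm ((deriv ^^ l) h z) \<le> fact l * B / (r / 2) ^ l"
        using r by (intro Cauchy_inequality holomorphic_on_subset[OF h]
            continuous_on_subset[OF holomorphic_on_imp_continuous_on[OF h]]) auto
      then have "r ^ l * norm ((deriv ^^ l) h z) \<le> fact l * 2 ^ l * B"
        using r by (simp add: field_simps)
      then have "(r ^ l * norm ((deriv ^^ l) h z)) powr p \<le> (fact l * 2 ^ l * B) powr p"
        using p r by (intro powr_mono2) auto
      also have "\<dots> = (fact l * 2 ^ l) powr p * (4 * C0 * J' / r\<^sup>2)"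
        using p J' C0 by (simp add: powr_mult B_def powr_powr)
      finally have "r\<^sup>2 * (r ^ l * norm ((deriv ^^ l) h z)) powr p \<le> C * J'"
        using r by (simp add: C_def field_simps)
      then show ?thesis
        using J' \<open>C > 0\<close> by (simp add: ennreal_mult'[symmetric] ennreal_leI)
    qed
  qed
qed

section \<open>Weighted integrals of derivatives on the disc\<close>

lemma disc_lambda_eq:
  "disc_lambda = density lborel (\<lambda>z. ennreal (indicator (ball 0 1) z / (pi * (1 - (norm z)\<^sup>2)\<^sup>2)))"
proof -
  have [measurable]: "ball 0 1 \<in> sets (borel :: complex measure)" by simp
  have "disc_lambda = density lborel (\<lambda>z. ennreal (indicator (ball 0 1) z / pi) * ennreal (1 / (1 - (norm z)\<^sup>2)\<^sup>2))"
    unfolding disc_lambda_def disc_area_def by (rule density_density_eq) simp_all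
  also have "(\<lambda>z::complex. ennreal (indicator (ball 0 1) z / pi) * ennreal (1 / (1 - (norm z)\<^sup>2)\<^sup>2))
     = (\<lambda>z. ennreal (indicator (ball 0 1) z / (pi * (1 - (norm z)\<^sup>2)\<^sup>2)))"
    by (auto simp: ennreal_mult''[symmetric])
  finally show ?thesis .
qed

lemma sets_disc_lambda [measurable_cong, simp]: "sets disc_lambda = sets borel"
  by (simp add: disc_lambda_eq)

lemma space_disc_lambda [simp]: "space disc_lambda = UNIV"
  by (simp add: disc_lambda_eq)

lemma disc_lambda_density_measurable [measurable]:
  "(\<lambda>z::complex. indicator (ball 0 1) z / (pi * (1 - (norm z)\<^sup>2)\<^sup>2)) \<in> borel_measurable borel"
proof -
  have [measurable]: "ball 0 1 \<in> sets (borel :: complex measure)" by simp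
  show ?thesis by simp
qed

lemma nn_integral_disc_lambda:
  assumes [measurable]: "F \<in> borel_measurable borel"
  shows "(\<integral>\<^sup>+z. F z \<partial>disc_lambda)
    = (\<integral>\<^sup>+z. ennreal (indicator (ball 0 1) z / (pi * (1 - (norm z)\<^sup>2)\<^sup>2)) * F z \<partial>lborel)"
  unfolding disc_lambda_eq by (rule nn_integral_density) simp_all

lemma AE_disc_lambda: "AE z in disc_lambda. z \<in> ball 0 1"
  unfolding disc_lambda_eq by (subst AE_density) (auto simp: indicator_def)

interpretation disc_lambda: sigma_finite_measure disc_lambda
  unfolding disc_lambda_eq
  by (subst sigma_finite_measure.sigma_finite_iff_density_finite[OF sigma_finite_lborel]) auto

interpretation disc_lambda_pair: pair_sigma_finite disc_lambda disc_lambda ..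

text \<open>The argument \<open>h\<close> is the function after differentiation, so the exponent
  \<open>n\<close> of the weight is independent of any order of derivative. The indicator discards
  the unknown values outside the disc and so keeps the density Borel measurable on the
  plane.\<close>

definition besov_density :: "real \<Rightarrow> nat \<Rightarrow> (complex \<Rightarrow> complex) \<Rightarrow> complex \<Rightarrow> ennreal" where
  "besov_density p n h z = ennreal (((1 - (norm z)\<^sup>2) ^ n * norm (h z)) powr p) * indicator (ball 0 1) z"

lemma one_minus_norm_bounds:
  fixes z :: "'a::real_normed_vector"
  assumes "z \<in> ball 0 1"
  shows "0 < 1 - norm z" "1 - norm z \<le> 1 - (norm z)\<^sup>2" "1 - (norm z)\<^sup>2 \<le> 2 * (1 - norm z)" "0 < 1 - (norm z)\<^sup>2"
proof -
  have eq: "1 - (norm z)\<^sup>2 = (1 - norm z) * (1 + norm z)"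
    by (simp add: algebra_simps power2_eq_square)
  show pos: "0 < 1 - norm z" using assms by simp
  show "1 - norm z \<le> 1 - (norm z)\<^sup>2"
    unfolding eq using mult_left_mono[of 1 "1 + norm z" "1 - norm z"] pos by simp
  then show "0 < 1 - (norm z)\<^sup>2" using pos by linarith
  show "1 - (norm z)\<^sup>2 \<le> 2 * (1 - norm z)"
    unfolding eq using mult_left_mono[of "1 + norm z" 2 "1 - norm z"] pos by simp
qed

lemma besov_density_measurable:
  assumes "h holomorphic_on ball 0 1" "p > 0"
  shows "besov_density p n h \<in> borel_measurable borel"
  unfolding besov_density_def[abs_def]
proof (intro powr_norm_measurable continuous_intros holomorphic_on_imp_continuous_on)
  show "0 \<le> (1 - (norm z)\<^sup>2) ^ n * norm (h z)" if "z \<in> ball 0 1" for z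
    using one_minus_norm_bounds(4)[OF that] by simp
qed (use assms in auto)

text \<open>On the disc of radius \<open>r = (1 - norm z) / 2\<close> about \<open>z\<close> the
  weight \<open>1 - (norm w)\<^sup>2\<close> lies between \<open>r\<close> and \<open>6 * r\<close>.
  Hence all weights can be exchanged for powers of \<open>r\<close>, and the
  \<open>r\<^sup>2\<close> of the sub-mean value inequality is absorbed by the density of
  \<open>disc_lambda\<close>.\<close>

lemma besov_density_deriv_le:
  assumes p: "p > 0"
  obtains C where "C > 0" "\<And>h z. h holomorphic_on ball 0 1 \<Longrightarrow> z \<in> ball 0 1 \<Longrightarrow>
    besov_density p (n + l) ((deriv ^^ l) h) z
      \<le> ennreal C * (\<integral>\<^sup>+w\<in>ball z ((1 - norm z) / 2). besov_density p n h w \<partial>disc_lambda)"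
proof -
  obtain C0 where C0: "C0 > 0" "\<And>h z r. h holomorphic_on ball z r \<Longrightarrow> r > 0 \<Longrightarrow>
    ennreal (r\<^sup>2 * (r ^ l * norm ((deriv ^^ l) h z)) powr p)
      \<le> ennreal C0 * (\<integral>\<^sup>+w\<in>ball z r. norm (h w) powr p \<partial>lborel)"
    using submean_powr_deriv[OF p] by blast
  \<comment> \<open>\<open>4 ^ (n + l)\<close> comes from
    \<open>1 - (norm z)\<^sup>2 \<le> 4 * r\<close>, and \<open>36 * pi\<close> from the density of
    \<open>disc_lambda\<close> where the weight is at most \<open>6 * r\<close>.\<close>
  define C where "C = (4 ^ (n + l)) powr p * (C0 * (36 * pi))"
  show thesis
  proof
    show "C > 0" using C0 by (simp add: C_def)
    fix h and z :: complex
    assume h: "h holomorphic_on ball 0 1" and z: "z \<in> ball 0 1"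
    define r where "r = (1 - norm z) / 2"
    have r: "r > 0" using z by (simp add: r_def)
    have w_bounds: "norm w < 1" "r \<le> 1 - (norm w)\<^sup>2" "1 - (norm w)\<^sup>2 \<le> 6 * r" if w: "w \<in> ball z r" for w
    proof -
      have "1 - norm z = 2 * r" by (simp add: r_def)
      have *: "norm w \<le> norm z + r" "norm z \<le> norm w + r"
        using w norm_triangle_ineq2[of w z] norm_triangle_ineq2[of z w]
        by (simp_all add: dist_norm norm_minus_commute)
      note * = * \<open>1 - norm z = 2 * r\<close>
      from * show "norm w < 1" using r by linarith
      then have "w \<in> ball 0 1" by simp
      note b = one_minus_norm_bounds[OF this]
      show "r \<le> 1 - (norm w)\<^sup>2" using * b by linarith
      have "2 * (1 - norm w) \<le> 6 * r" using * by simp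
      with b(3) show "1 - (norm w)\<^sup>2 \<le> 6 * r" by (rule order_trans)
    qed
    then have sub: "ball z r \<subseteq> ball 0 1" by auto
    define A where "A = (\<integral>\<^sup>+w\<in>ball z r. besov_density p n h w \<partial>disc_lambda)"
    define K where "K = 36 * pi * r\<^sup>2 / (r ^ n) powr p"
    have K: "K > 0" using r by (simp add: K_def)
    note [measurable] = besov_density_measurable[OF h p]
    have "(\<integral>\<^sup>+w\<in>ball z r. norm (h w) powr p \<partial>lborel)
       \<le> (\<integral>\<^sup>+w. ennreal K * (ennreal (indicator (ball 0 1) w / (pi * (1 - (norm w)\<^sup>2)\<^sup>2))
             * (besov_density p n h w * indicator (ball z r) w)) \<partial>lborel)"
    proof (rule nn_integral_mono)
      fix w
      show "ennreal (norm (h w) powr p) * indicator (ball z r) w \<le> 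
        ennreal K * (ennreal (indicator (ball 0 1) w / (pi * (1 - (norm w)\<^sup>2)\<^sup>2))
             * (besov_density p n h w * indicator (ball z r) w))"
      proof (cases "w \<in> ball z r")
        case True
        define s where "s = 1 - (norm w)\<^sup>2"
        have s: "r \<le> s" "s \<le> 6 * r" "0 < s" using w_bounds[OF True] r by (auto simp: s_def)
        have "(r ^ n) powr p * norm (h w) powr p * (s\<^sup>2) \<le> (s ^ n) powr p * norm (h w) powr p * (36 * r\<^sup>2)"
        proof (intro mult_mono powr_mono2 power_mono)
          have "s\<^sup>2 \<le> (6 * r)\<^sup>2" using s by (intro power_mono) auto
          then show "s\<^sup>2 \<le> 36 * r\<^sup>2" by (simp add: power_mult_distrib)
        qed (use s p r in auto)
        then have "norm (h w) powr p \<le> K * (1 / (pi * s\<^sup>2) * ((s ^ n * norm (h w)) powr p))"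
          using r s by (simp add: K_def powr_mult field_simps)
        then show ?thesis
          using True sub K s
          by (auto simp: besov_density_def s_def[symmetric] ennreal_mult'[symmetric] ennreal_mult''[symmetric] intro!: ennreal_leI)
      qed simp
    qed
    also have "\<dots> = ennreal K * A"
    proof -
      have [measurable]: "ball z r \<in> sets borel" by simp
      have m: "(\<lambda>w. besov_density p n h w * indicator (ball z r) w) \<in> borel_measurable borel"
        by measurable
      then have "(\<lambda>w. ennreal (indicator (ball 0 1) w / (pi * (1 - (norm w)\<^sup>2)\<^sup>2))
             * (besov_density p n h w * indicator (ball z r) w)) \<in> borel_measurable lborel"
        by measurable
      then show ?thesis
        unfolding A_def nn_integral_disc_lambda[OF m] by (rule nn_integral_cmult)
    qed
    finally have le: "(\<integral>\<^sup>+w\<in>ball z r. norm (h w) powr p \<partial>lborel) \<le> ennreal K * A" .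
    define D where "D = norm ((deriv ^^ l) h z)"
    have "ennreal (r\<^sup>2 * (r ^ l * D) powr p) \<le> ennreal C0 * (ennreal K * A)"
      unfolding D_def
      by (rule order_trans[OF C0(2)[OF holomorphic_on_subset[OF h sub] r] mult_left_mono[OF le]]) simp
    have "ennreal (((1 - (norm z)\<^sup>2) ^ (n + l) * D) powr p) \<le> ennreal C * A"
    proof (cases "A = \<infinity>")
      case True
      then show ?thesis using \<open>C > 0\<close> by (auto simp: ennreal_mult_top)
    next
      case False
      then obtain A' where A': "A' \<ge> 0" "A = ennreal A'" 
        by (cases A) auto
      have "r\<^sup>2 * (r ^ l * D) powr p \<le> C0 * (K * A')"
        using \<open>ennreal (r\<^sup>2 * (r ^ l * D) powr p) \<le> ennreal C0 * (ennreal K * A)\<close> A' K C0(1)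
        by (simp add: ennreal_mult'[symmetric] ennreal_le_iff)
      then have "(r ^ n) powr p * (r ^ l * D) powr p \<le> C0 * (36 * pi) * A'"
        using r by (simp add: K_def field_simps)
      then have le: "(r ^ (n + l) * D) powr p \<le> C0 * (36 * pi) * A'"
        using r by (simp add: power_add powr_mult D_def)
      have "((1 - (norm z)\<^sup>2) ^ (n + l) * D) powr p \<le> ((4 * r) ^ (n + l) * D) powr p"
        using one_minus_norm_bounds[OF z] p
        by (intro powr_mono2 mult_right_mono power_mono) (auto simp: r_def D_def)
      also have "\<dots> = (4 ^ (n + l)) powr p * (r ^ (n + l) * D) powr p"
        using r by (simp add: power_mult_distrib powr_mult D_def)
      also have "\<dots> \<le> C * A'"
        using le by (simp add: C_def mult.assoc mult_left_mono)
      finally show ?thesis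
        using A' \<open>C > 0\<close> by (simp add: ennreal_mult'[symmetric] ennreal_leI)
    qed
    then show "besov_density p (n + l) ((deriv ^^ l) h) z
      \<le> ennreal C * (\<integral>\<^sup>+w\<in>ball z ((1 - norm z) / 2). besov_density p n h w \<partial>disc_lambda)"
      using z by (simp add: besov_density_def D_def A_def r_def)
  qed
qed

text \<open>At order \<open>n\<close> this is the case \<open>l = 0\<close> of
  \<open>besov_density_deriv_le\<close>, with the local integral bounded by the total one. Each
  lower order follows from a mean value bound starting at 0; the exponent is kept at
  \<open>n\<close> and the value at 0 goes into the constant.\<close>

lemma besov_growth:
  assumes h: "h holomorphic_on ball 0 1" and p: "p > 0"
    and fin: "(\<integral>\<^sup>+w. besov_density p n ((deriv ^^ n) h) w \<partial>disc_lambda) < \<infinity>"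
    and "k \<le> n"
  shows "\<exists>C\<ge>0. \<forall>z\<in>ball 0 1. norm ((deriv ^^ k) h z) \<le> C / (1 - norm z) ^ n"
  using \<open>k \<le> n\<close>
proof (induction rule: inc_induct)
  case base
  have hn: "(deriv ^^ n) h holomorphic_on ball 0 1"
    using h by (intro holomorphic_higher_deriv) auto
  define J where "J = (\<integral>\<^sup>+w. besov_density p n ((deriv ^^ n) h) w \<partial>disc_lambda)"
  obtain J' where J': "J' \<ge> 0" "J = ennreal J'" 
    using fin by (cases J) (auto simp: J_def)
  obtain C where C: "C > 0" "\<And>h z. h holomorphic_on ball 0 1 \<Longrightarrow> z \<in> ball 0 1 \<Longrightarrow>
    besov_density p (n + 0) ((deriv ^^ 0) h) z
      \<le> ennreal C * (\<integral>\<^sup>+w\<in>ball z ((1 - norm z) / 2). besov_density p n h w \<partial>disc_lambda)"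
    using besov_density_deriv_le[OF p, of n 0] by blast
  have "norm ((deriv ^^ n) h z) \<le> (C * J') powr (1 / p) / (1 - norm z) ^ n" if z: "z \<in> ball 0 1" for z
  proof -
    define D where "D = norm ((deriv ^^ n) h z)"
    have "ennreal (((1 - (norm z)\<^sup>2) ^ n * D) powr p) \<le> ennreal C * (\<integral>\<^sup>+w\<in>ball z ((1 - norm z) / 2). besov_density p n ((deriv ^^ n) h) w \<partial>disc_lambda)"
      using C(2)[OF hn z] z by (simp add: besov_density_def D_def)
    also have "\<dots> \<le> ennreal C * J"
      unfolding J_def by (intro mult_left_mono nn_integral_mono) (auto simp: indicator_def)
    finally have "((1 - (norm z)\<^sup>2) ^ n * D) powr p \<le> C * J'"
      using J' C by (simp add: ennreal_mult'[symmetric] ennreal_le_iff)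
    then have "(((1 - (norm z)\<^sup>2) ^ n * D) powr p) powr (1 / p) \<le> (C * J') powr (1 / p)"
      using p by (intro powr_mono2) auto
    then have "(1 - (norm z)\<^sup>2) ^ n * D \<le> (C * J') powr (1 / p)"
      using p one_minus_norm_bounds[OF z] by (simp add: powr_powr D_def)
    moreover have "(1 - norm z) ^ n * D \<le> (1 - (norm z)\<^sup>2) ^ n * D"
      using one_minus_norm_bounds[OF z] by (intro mult_right_mono power_mono) (auto simp: D_def)
    ultimately show ?thesis
      using z by (simp add: D_def[symmetric] field_simps)
  qed
  then show ?case by (intro exI[of _ "(C * J') powr (1 / p)"]) auto
next
  case (step k)
  then obtain C where C: "C \<ge> 0" "\<And>z. z \<in> ball 0 1 \<Longrightarrow> norm ((deriv ^^ Suc k) h z) \<le> C / (1 - norm z) ^ n"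
    by blast
  have "norm ((deriv ^^ k) h z) \<le> (C + norm ((deriv ^^ k) h 0)) / (1 - norm z) ^ n" if z: "z \<in> ball 0 1" for z
  proof -
    have "norm ((deriv ^^ k) h z - (deriv ^^ k) h 0) \<le> C / (1 - norm z) ^ n * norm (z - 0)"
    \<comment> \<open>This closed disc is convex, and the growth bound for the next derivative is
      largest on its boundary.\<close>
    proof (rule field_differentiable_bound[where S = "cball 0 (norm z)"])
      fix w :: complex assume w: "w \<in> cball 0 (norm z)"
      then have w1: "w \<in> ball 0 1" using z by auto
      have "(deriv ^^ k) h holomorphic_on ball 0 1"
        using h by (intro holomorphic_higher_deriv) auto
      then show "((deriv ^^ k) h has_field_derivative (deriv ^^ Suc k) h w) (at w within cball 0 (norm z))"
        using holomorphic_derivI[OF _ open_ball w1] by simp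
      have "norm ((deriv ^^ Suc k) h w) \<le> C / (1 - norm w) ^ n"
        using C w1 by blast
      also have "\<dots> \<le> C / (1 - norm z) ^ n"
        using w z C by (intro divide_left_mono power_mono mult_pos_pos) auto
      finally show "norm ((deriv ^^ Suc k) h w) \<le> C / (1 - norm z) ^ n" .
    qed auto
    also have "\<dots> \<le> C / (1 - norm z) ^ n"
      using z C by (intro mult_left_le) auto
    finally have "norm ((deriv ^^ k) h z - (deriv ^^ k) h 0) \<le> C / (1 - norm z) ^ n" .
    moreover have "(1 - norm z) ^ n \<le> 1"
      using z by (intro power_le_one) auto
    then have "norm ((deriv ^^ k) h 0) \<le> norm ((deriv ^^ k) h 0) / (1 - norm z) ^ n"
      using z by (simp add: field_simps mult_left_le_one_le)
    ultimately show ?thesis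
      using norm_triangle_ineq2[of "(deriv ^^ k) h z" "(deriv ^^ k) h 0"] by (simp add: add_divide_distrib)
  qed
  then show ?case using C by (intro exI[of _ "C + norm ((deriv ^^ k) h 0)"]) auto
qed

section \<open>Composition with a disc automorphism\<close>

definition disc_moebius :: "complex \<Rightarrow> complex \<Rightarrow> complex" where
  "disc_moebius a z = (a - z) / (1 - cnj a * z)"

lemma disc_moebius_holomorphic: "disc_moebius a holomorphic_on {z. 1 - cnj a * z \<noteq> 0}"
  unfolding disc_moebius_def[abs_def] by (intro holomorphic_intros) auto

lemma open_disc_moebius_domain: "open {z. 1 - cnj a * z \<noteq> 0}"
  by (intro open_Collect_neq continuous_intros)

lemma disc_moebius_measurable [measurable]: "disc_moebius a \<in> borel_measurable borel"
  unfolding disc_moebius_def[abs_def] by measurable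

text \<open>The disc is the one over which \<open>besov_density_deriv_le\<close> integrates at the
  point \<open>disc_moebius a z\<close>. Written as a relation it can also be read for fixed
  \<open>w\<close>, as the exchange of integrals requires.\<close>

definition hyp_near :: "complex \<Rightarrow> complex \<Rightarrow> complex \<Rightarrow> bool" where
  "hyp_near a z w \<longleftrightarrow> z \<in> ball 0 1 \<and> w \<in> ball (disc_moebius a z) ((1 - norm (disc_moebius a z)) / 2)"

lemma hyp_near_measurable:
  "Measurable.pred (disc_lambda \<Otimes>\<^sub>M disc_lambda) (\<lambda>(z, w). hyp_near a z w)"
  unfolding hyp_near_def mem_ball by measurable

context
  fixes a :: complex
  assumes a: "norm a < 1"
begin

lemma disc_moebius_denom:
  assumes "norm z \<le> 1"
  shows "1 - norm a \<le> norm (1 - cnj a * z)" "norm (1 - cnj a * z) \<le> 2" "1 - cnj a * z \<noteq> 0"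
proof -
  have le: "norm (cnj a * z) \<le> norm a"
    using assms by (simp add: norm_mult mult_left_le)
  then show 1: "1 - norm a \<le> norm (1 - cnj a * z)"
    using norm_triangle_ineq2[of 1 "cnj a * z"] by simp
  show "norm (1 - cnj a * z) \<le> 2"
    using norm_triangle_ineq4[of 1 "cnj a * z"] le a by simp
  show "1 - cnj a * z \<noteq> 0"
    using 1 a by auto
qed

lemma one_minus_norm_disc_moebius:
  assumes "norm z \<le> 1"
  shows "1 - (norm (disc_moebius a z))\<^sup>2
    = (1 - (norm a)\<^sup>2) * (1 - (norm z)\<^sup>2) / (norm (1 - cnj a * z))\<^sup>2"
proof -
  have "(norm (1 - cnj a * z))\<^sup>2 - (norm (a - z))\<^sup>2 = (1 - (norm a)\<^sup>2) * (1 - (norm z)\<^sup>2)"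
    unfolding cmod_power2 by (simp add: algebra_simps power2_eq_square)
  then show ?thesis
    using disc_moebius_denom(3)[OF assms]
    by (simp add: disc_moebius_def norm_divide power_divide divide_simps)
qed

lemma disc_moebius_in_ball:
  assumes "z \<in> ball 0 1"
  shows "disc_moebius a z \<in> ball 0 1"
proof -
  have "0 < 1 - (norm (disc_moebius a z))\<^sup>2"
    using assms one_minus_norm_bounds(4)[of a] one_minus_norm_bounds(4)[of z] a disc_moebius_denom(3)[of z]
    by (subst one_minus_norm_disc_moebius) auto
  then show ?thesis
    by (simp add: power_less_one_iff abs_square_less_1)
qed

text \<open>In the preceding identity the denominator is at most 2 in norm and 1 - |a|^2 >= 1 - |a|.
  Since the map is an involution, applying this at the image of \<open>z\<close> also bounds
  \<open>1 - (norm z)\<^sup>2\<close> from below.\<close>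

lemma one_minus_norm_disc_moebius_ge:
  assumes z: "z \<in> ball 0 1"
  shows "(1 - norm a) / 4 * (1 - (norm z)\<^sup>2) \<le> 1 - (norm (disc_moebius a z))\<^sup>2"
proof -
  have z': "norm z \<le> 1" using z by simp
  have "(norm (1 - cnj a * z))\<^sup>2 \<le> 2\<^sup>2"
    using disc_moebius_denom(2)[OF z'] by (intro power_mono) auto
  moreover have "1 - norm a \<le> 1 - (norm a)\<^sup>2"
    using one_minus_norm_bounds(2)[of a] a by simp
  ultimately have "(1 - norm a) * (1 - (norm z)\<^sup>2) / 4
      \<le> (1 - (norm a)\<^sup>2) * (1 - (norm z)\<^sup>2) / (norm (1 - cnj a * z))\<^sup>2"
    using one_minus_norm_bounds[OF z] disc_moebius_denom(3)[OF z'] a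
    by (intro frac_le mult_right_mono) auto
  then show ?thesis
    unfolding one_minus_norm_disc_moebius[OF z'] by simp
qed

lemma disc_moebius_involution:
  assumes z: "z \<in> ball 0 1"
  shows "disc_moebius a (disc_moebius a z) = z"
proof -
  define d where "d = 1 - cnj a * z"
  have d: "d \<noteq> 0" using z disc_moebius_denom(3)[of z] by (simp add: d_def)
  have "1 - cnj a * a \<noteq> 0" using a disc_moebius_denom(3)[of a] by simp
  moreover have "a - (a - z) / d = (1 - cnj a * a) * z / d"
    using d by (simp add: field_simps) (simp add: d_def algebra_simps)
  moreover have "1 - cnj a * ((a - z) / d) = (1 - cnj a * a) / d"
    using d by (simp add: field_simps) (simp add: d_def algebra_simps)
  ultimately show ?thesis
    using d by (simp add: disc_moebius_def d_def[symmetric])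
qed

text \<open>The difference of two values has the closed form
  \<open>(w - z) * (1 - cnj a * a) / (d * e)\<close>, up to sign of no importance to the distance.
  The factor \<open>1 - cnj a * a\<close> is at most \<open>2 * \<delta>\<close> in norm and both
  denominators are at least \<open>\<delta>\<close>.\<close>

lemma dist_disc_moebius_le:
  assumes z: "z \<in> ball 0 1" and w: "w \<in> ball 0 1"
  shows "dist (disc_moebius a z) (disc_moebius a w) \<le> 2 / (1 - norm a) * dist z w"
proof -
  define \<delta> where "\<delta> = 1 - norm a"
  have \<delta>: "\<delta> > 0" using a by (simp add: \<delta>_def)
  define d e where "d = 1 - cnj a * z" and "e = 1 - cnj a * w"
  have d: "\<delta> \<le> norm d" "d \<noteq> 0" and e: "\<delta> \<le> norm e" "e \<noteq> 0"
    using z w disc_moebius_denom[of z] disc_moebius_denom[of w] by (simp_all add: d_def e_def \<delta>_def)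
  have "1 - cnj a * a = of_real (1 - (norm a)\<^sup>2)"
    using complex_norm_square[of a] by (simp add: mult.commute)
  then have "norm (1 - cnj a * a) = 1 - (norm a)\<^sup>2"
    using one_minus_norm_bounds(4)[of a] a by (simp add: norm_of_real del: of_real_diff of_real_power)
  then have aa: "norm (1 - cnj a * a) \<le> 2 * \<delta>"
    using one_minus_norm_bounds(3)[of a] a by (simp add: \<delta>_def)
  have "(a - z) / d - (a - w) / e = (w - z) * (1 - cnj a * a) / (d * e)"
    using d e by (simp add: field_simps) (simp add: d_def e_def algebra_simps)
  then have "dist (disc_moebius a z) (disc_moebius a w) = dist z w * norm (1 - cnj a * a) / (norm d * norm e)"
    by (simp add: disc_moebius_def d_def[symmetric] e_def[symmetric] dist_norm norm_divide norm_mult norm_minus_commute)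
  also have "\<dots> \<le> dist z w * (2 * \<delta>) / (\<delta> * \<delta>)"
    using aa d e \<delta> by (intro frac_le mult_mono mult_left_mono) auto
  also have "\<dots> = 2 / \<delta> * dist z w"
    using \<delta> by simp
  finally show ?thesis by (simp add: \<delta>_def)
qed

lemma ball_subset_disc_moebius_domain: "cball 0 1 \<subseteq> {z. 1 - cnj a * z \<noteq> 0}"
  using disc_moebius_denom(3) by auto

text \<open>The coefficients are holomorphic on a neighbourhood of the closed disc, not only on the
  open one; compactness will bound them. Their exact form never matters, so they are produced by
  induction through the product and chain rules.\<close>

lemma higher_deriv_compose_disc_moebius:
  assumes h: "h holomorphic_on ball 0 1"
  shows "\<exists>P. (\<forall>k. P k holomorphic_on {z. 1 - cnj a * z \<noteq> 0}) \<and>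
    (\<forall>z\<in>ball 0 1. (deriv ^^ m) (h \<circ> disc_moebius a) z = (\<Sum>k\<le>m. (deriv ^^ k) h (disc_moebius a z) * P k z))"
proof (induction m)
  case 0
  show ?case by (intro exI[of _ "\<lambda>_ _. 1"]) auto
next
  case (Suc m)
  define U where "U = {z. 1 - cnj a * z \<noteq> 0}"
  have U: "open U" "ball 0 1 \<subseteq> U"
    using open_disc_moebius_domain order_trans[OF ball_subset_cball ball_subset_disc_moebius_domain]
    by (simp_all only: U_def)
  let ?T = "disc_moebius a"
  have T: "?T holomorphic_on U" using disc_moebius_holomorphic by (simp add: U_def)
  obtain P where P: "\<And>k. P k holomorphic_on U"
    "\<And>z. z \<in> ball 0 1 \<Longrightarrow> (deriv ^^ m) (h \<circ> ?T) z = (\<Sum>k\<le>m. (deriv ^^ k) h (?T z) * P k z)"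
    using Suc unfolding U_def by blast
  \<comment> \<open>\<open>A\<close> collects the terms where a coefficient is differentiated,
    \<open>B\<close> those where the chain rule raises the order by one, hence its shifted index.
    The zero values at \<open>k = Suc m\<close> and at \<open>k = 0\<close> let both sums run over
    the same range.\<close>
  define A where "A k z = (if k \<le> m then deriv (P k) z else 0)" for k z
  define B where "B k z = (case k of 0 \<Rightarrow> 0 | Suc k \<Rightarrow> deriv ?T z * P k z)" for k z
  have A: "A k holomorphic_on U" for k
    unfolding A_def[abs_def] using U P by (cases "k \<le> m") (auto intro: holomorphic_deriv)
  have B: "B k holomorphic_on U" for k
    unfolding B_def[abs_def] using U P T by (cases k) (auto intro!: holomorphic_on_mult holomorphic_deriv)
  have "(\<lambda>z. A k z + B k z) holomorphic_on U" for k
    by (intro holomorphic_on_add A B)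
  moreover have "(deriv ^^ Suc m) (h \<circ> ?T) z = (\<Sum>k\<le>Suc m. (deriv ^^ k) h (?T z) * (A k z + B k z))"
    if z: "z \<in> ball 0 1" for z
  proof -
    have Tz: "?T z \<in> ball 0 1" using disc_moebius_in_ball[OF z] .
    have dT: "(?T has_field_derivative deriv ?T z) (at z)"
      using holomorphic_derivI[OF T U(1)] z U by auto
    have dP: "(P k has_field_derivative deriv (P k) z) (at z)" for k
      using holomorphic_derivI[OF P(1) U(1)] z U by auto
    have dh: "((deriv ^^ k) h has_field_derivative (deriv ^^ Suc k) h (?T z)) (at (?T z))" for k
      using holomorphic_derivI[OF holomorphic_higher_deriv[OF h open_ball] open_ball Tz] by simp
    have dhT: "((\<lambda>z. (deriv ^^ k) h (?T z)) has_field_derivative (deriv ^^ Suc k) h (?T z) * deriv ?T z) (at z)" for k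
      using DERIV_chain2[OF dh dT] .
    have "((\<lambda>z. \<Sum>k\<le>m. (deriv ^^ k) h (?T z) * P k z) has_field_derivative
        (\<Sum>k\<le>m. ((deriv ^^ Suc k) h (?T z) * deriv ?T z) * P k z + deriv (P k) z * (deriv ^^ k) h (?T z))) (at z)"
      by (intro DERIV_sum DERIV_mult dhT dP)
    then have "((deriv ^^ m) (h \<circ> ?T) has_field_derivative
        (\<Sum>k\<le>m. ((deriv ^^ Suc k) h (?T z) * deriv ?T z) * P k z + deriv (P k) z * (deriv ^^ k) h (?T z))) (at z)"
      using P(2) by (elim has_field_derivative_transform_within_open[OF _ open_ball z]) auto
    then have "(deriv ^^ Suc m) (h \<circ> ?T) z =
        (\<Sum>k\<le>m. ((deriv ^^ Suc k) h (?T z) * deriv ?T z) * P k z + deriv (P k) z * (deriv ^^ k) h (?T z))"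
      by (simp add: DERIV_imp_deriv)
    also have "\<dots> = (\<Sum>k\<le>m. (deriv ^^ k) h (?T z) * A k z) + (\<Sum>k\<le>m. (deriv ^^ Suc k) h (?T z) * B (Suc k) z)"
      by (simp add: A_def B_def sum.distrib mult_ac add_ac)
    also have "(\<Sum>k\<le>m. (deriv ^^ k) h (?T z) * A k z) = (\<Sum>k\<le>Suc m. (deriv ^^ k) h (?T z) * A k z)"
      by (simp add: A_def)
    also have "(\<Sum>k\<le>m. (deriv ^^ Suc k) h (?T z) * B (Suc k) z) = (\<Sum>k\<le>Suc m. (deriv ^^ k) h (?T z) * B k z)"
      by (simp only: sum.atMost_Suc_shift) (simp add: B_def)
    finally show ?thesis by (simp only: sum.distrib distrib_left)
  qed
  ultimately show ?case unfolding U_def by (intro exI[of _ "\<lambda>k z. A k z + B k z"]) blast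
qed

text \<open>With \<open>s = 1 - norm w\<close>, every such \<open>z\<close> lies in a disc of radius
  \<open>2 / \<delta> * s\<close> and has weight at least \<open>\<delta> * s / 6\<close>. Area and
  density scale as \<open>s\<^sup>2\<close> and its inverse, so \<open>s\<close> cancels, leaving 36
  * 4 = 144 over the fourth power of \<open>\<delta>\<close>. For \<open>w\<close> outside the unit
  disc no such \<open>z\<close> exists.\<close>

lemma nn_integral_hyp_near_le:
  "(\<integral>\<^sup>+z. indicator {z. hyp_near a z w} z \<partial>disc_lambda) \<le> ennreal (144 / (1 - norm a) ^ 4)"
proof (cases "norm w < 1")
  case True
  define \<delta> where "\<delta> = 1 - norm a"
  have \<delta>: "\<delta> > 0" using a by (simp add: \<delta>_def)
  define s where "s = 1 - norm w"
  have s: "s > 0" using True by (simp add: s_def)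
  let ?T = "disc_moebius a"
  have near: "z \<in> ball (?T w) (2 / \<delta> * s)" "\<delta> * s / 6 \<le> 1 - (norm z)\<^sup>2" if "hyp_near a z w" for z
  proof -
    define u where "u = ?T z"
    have z: "z \<in> ball 0 1" and uw: "dist u w < (1 - norm u) / 2"
      using that by (auto simp: hyp_near_def u_def)
    have u: "u \<in> ball 0 1" using disc_moebius_in_ball[OF z] by (simp add: u_def)
    have Tu: "?T u = z" using disc_moebius_involution[OF z] by (simp add: u_def)
    have *: "norm w \<le> norm u + dist u w" "norm u \<le> norm w + dist u w"
      using norm_triangle_ineq2[of w u] norm_triangle_ineq2[of u w]
      by (simp_all add: dist_norm norm_minus_commute)
    have "dist u w < s" using * uw by (simp add: s_def)
    then have "2 / \<delta> * dist u w < 2 / \<delta> * s"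
      using \<delta> by (intro mult_strict_left_mono) auto
    then show "z \<in> ball (?T w) (2 / \<delta> * s)"
      using dist_disc_moebius_le[OF u, of w] True unfolding Tu \<delta>_def by (simp add: dist_commute)
    \<comment> \<open>Moving from \<open>u\<close> to \<open>w\<close> raises the distance to the
      unit circle by at most half of \<open>1 - norm u\<close>, so \<open>s\<close> is at most 3/2
      of it.\<close>
    have "2 * s / 3 \<le> 1 - norm u" using * uw by (simp add: s_def)
    also have "\<dots> \<le> 1 - (norm u)\<^sup>2" using one_minus_norm_bounds[OF u] by simp
    finally have "\<delta> / 4 * (2 * s / 3) \<le> \<delta> / 4 * (1 - (norm u)\<^sup>2)"
      using \<delta> by (intro mult_left_mono) auto
    also have "\<dots> \<le> 1 - (norm z)\<^sup>2"
      using one_minus_norm_disc_moebius_ge[OF u] unfolding Tu \<delta>_def .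
    finally show "\<delta> * s / 6 \<le> 1 - (norm z)\<^sup>2" by simp
  qed
  have [measurable]: "{z. hyp_near a z w} \<in> sets borel"
    unfolding hyp_near_def mem_ball by measurable
  have "(\<integral>\<^sup>+z. indicator {z. hyp_near a z w} z \<partial>disc_lambda)
    = (\<integral>\<^sup>+z. ennreal (indicator (ball 0 1) z / (pi * (1 - (norm z)\<^sup>2)\<^sup>2)) * indicator {z. hyp_near a z w} z \<partial>lborel)"
    by (intro nn_integral_disc_lambda) measurable
  also have "\<dots> \<le> (\<integral>\<^sup>+z. ennreal (1 / (pi * (\<delta> * s / 6)\<^sup>2)) * indicator (ball (?T w) (2 / \<delta> * s)) z \<partial>lborel)"
  proof (rule nn_integral_mono)
    fix z
    show "ennreal (indicator (ball 0 1) z / (pi * (1 - (norm z)\<^sup>2)\<^sup>2)) * indicator {z. hyp_near a z w} z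
        \<le> ennreal (1 / (pi * (\<delta> * s / 6)\<^sup>2)) * indicator (ball (?T w) (2 / \<delta> * s)) z"
    proof (cases "hyp_near a z w")
      case True
      have pos: "0 < \<delta> * s / 6" using \<delta> s by simp
      then have pos': "0 < pi * (\<delta> * s / 6)\<^sup>2" by (intro mult_pos_pos zero_less_power) auto
      have "indicator (ball 0 1) z / (pi * (1 - (norm z)\<^sup>2)\<^sup>2) \<le> 1 / (pi * (\<delta> * s / 6)\<^sup>2)"
        using near(2)[OF True] pos pos'
        by (intro frac_le mult_left_mono power_mono) (auto simp: indicator_def)
      then show ?thesis using near(1)[OF True] True by (simp add: ennreal_leI)
    qed simp
  qed
  also have "\<dots> = ennreal (1 / (pi * (\<delta> * s / 6)\<^sup>2)) * emeasure lborel (ball (?T w) (2 / \<delta> * s))"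
    by (simp add: nn_integral_cmult_indicator)
  also have "\<dots> = ennreal (1 / (pi * (\<delta> * s / 6)\<^sup>2) * (pi * (2 / \<delta> * s)\<^sup>2))"
    using \<delta> s by (subst emeasure_ball) (auto simp: unit_ball_vol_2 ennreal_mult'[symmetric] simp del: ennreal_mult)
  also have "1 / (pi * (\<delta> * s / 6)\<^sup>2) * (pi * (2 / \<delta> * s)\<^sup>2) = 144 / \<delta> ^ 4"
    using \<delta> s by (simp add: field_simps power2_eq_square power4_eq_xxxx)
  finally show ?thesis by (simp add: \<delta>_def)
next
  case False
  have "\<not> hyp_near a z w" for z
  proof
    assume "hyp_near a z w"
    then have "dist (disc_moebius a z) w < (1 - norm (disc_moebius a z)) / 2" "norm (disc_moebius a z) < 1"
      using disc_moebius_in_ball by (auto simp: hyp_near_def)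
    then show False
      using False norm_triangle_ineq2[of w "disc_moebius a z"]
      by (simp add: dist_norm norm_minus_commute)
  qed
  then show ?thesis by simp
qed

text \<open>\<open>A\<close> is the local integral of \<open>besov_density_deriv_le\<close>, taken
  at the image point and regarded as a function of \<open>z\<close>. Its measurability is stated
  too, since the integral of a sum containing it will be split.\<close>

lemma hyp_near_average:
  assumes [measurable]: "\<Phi> \<in> borel_measurable borel"
  defines "A \<equiv> \<lambda>z. \<integral>\<^sup>+w. \<Phi> w * indicator {w. hyp_near a z w} w \<partial>disc_lambda"
  shows "A \<in> borel_measurable borel"
    and "(\<integral>\<^sup>+z. A z \<partial>disc_lambda) \<le> ennreal (144 / (1 - norm a) ^ 4) * (\<integral>\<^sup>+w. \<Phi> w \<partial>disc_lambda)"
proof -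
  have m: "(\<lambda>x. \<Phi> (snd x) * indicator {w. hyp_near a (fst x) w} (snd x)) \<in> borel_measurable (disc_lambda \<Otimes>\<^sub>M disc_lambda)"
  proof -
    have "(\<lambda>x. \<Phi> (snd x) * indicator {x. (\<lambda>(z, w). hyp_near a z w) x} x) \<in> borel_measurable (disc_lambda \<Otimes>\<^sub>M disc_lambda)"
      using hyp_near_measurable by measurable
    also have "(\<lambda>x. \<Phi> (snd x) * indicator {x. (\<lambda>(z, w). hyp_near a z w) x} x)
       = (\<lambda>x. \<Phi> (snd x) * indicator {w. hyp_near a (fst x) w} (snd x))"
      by (auto simp: indicator_def)
    finally show ?thesis .
  qed
  have "A \<in> borel_measurable disc_lambda"
    unfolding A_def
    by (rule disc_lambda.borel_measurable_nn_integral) (use m in \<open>simp add: split_beta\<close>)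
  then show "A \<in> borel_measurable borel" by (simp cong: measurable_cong_sets)
  have "(\<integral>\<^sup>+z. A z \<partial>disc_lambda)
      = (\<integral>\<^sup>+w. \<integral>\<^sup>+z. \<Phi> w * indicator {w. hyp_near a z w} w \<partial>disc_lambda \<partial>disc_lambda)"
    unfolding A_def
    by (rule disc_lambda_pair.Fubini'[symmetric]) (use m in \<open>simp add: split_beta\<close>)
  also have "\<dots> \<le> (\<integral>\<^sup>+w. ennreal (144 / (1 - norm a) ^ 4) * \<Phi> w \<partial>disc_lambda)"
  proof (rule nn_integral_mono)
    fix w
    have [measurable]: "{z. hyp_near a z w} \<in> sets borel"
      unfolding hyp_near_def mem_ball by measurable
    have "(\<integral>\<^sup>+z. \<Phi> w * indicator {w. hyp_near a z w} w \<partial>disc_lambda)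
        = (\<integral>\<^sup>+z. \<Phi> w * indicator {z. hyp_near a z w} z \<partial>disc_lambda)"
      by (intro nn_integral_cong) (simp add: indicator_def)
    also have "\<dots> = \<Phi> w * (\<integral>\<^sup>+z. indicator {z. hyp_near a z w} z \<partial>disc_lambda)"
      by (intro nn_integral_cmult) measurable
    also have "\<dots> \<le> \<Phi> w * ennreal (144 / (1 - norm a) ^ 4)"
      by (intro mult_left_mono nn_integral_hyp_near_le) auto
    finally show "(\<integral>\<^sup>+z. \<Phi> w * indicator {w. hyp_near a z w} w \<partial>disc_lambda) \<le> ennreal (144 / (1 - norm a) ^ 4) * \<Phi> w"
      by (simp add: mult.commute)
  qed
  also have "\<dots> = ennreal (144 / (1 - norm a) ^ 4) * (\<integral>\<^sup>+w. \<Phi> w \<partial>disc_lambda)"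
    by (rule nn_integral_cmult) measurable
  finally show "(\<integral>\<^sup>+z. A z \<partial>disc_lambda) \<le> ennreal (144 / (1 - norm a) ^ 4) * (\<integral>\<^sup>+w. \<Phi> w \<partial>disc_lambda)" .
qed

end

section \<open>The Besov integral of a composition on the disc\<close>

lemma powr_sum_le:
  fixes x :: "'a \<Rightarrow> real"
  assumes "finite A" "\<And>k. k \<in> A \<Longrightarrow> x k \<ge> 0" "p > 0"
  shows "(\<Sum>k\<in>A. x k) powr p \<le> real (card A) powr p * (\<Sum>k\<in>A. x k powr p)"
proof (cases "A = {}")
  case False
  have "Max (x ` A) \<in> x ` A" using False assms by (intro Max_in) auto
  then obtain k where k: "k \<in> A" "x k = Max (x ` A)" by auto
  \<comment> \<open>Replacing every term by the largest one treats \<open>p\<close> below and above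
    1 alike, without convexity or subadditivity.\<close>
  have "(\<Sum>k\<in>A. x k) \<le> (\<Sum>j\<in>A. x k)"
    using assms k by (intro sum_mono) (auto intro: Max_ge)
  then have "(\<Sum>k\<in>A. x k) powr p \<le> (real (card A) * x k) powr p"
    using assms by (intro powr_mono2) (auto intro: sum_nonneg)
  also have "\<dots> = real (card A) powr p * x k powr p"
    using assms k by (simp add: powr_mult)
  also have "\<dots> \<le> real (card A) powr p * (\<Sum>k\<in>A. x k powr p)"
    using assms k by (intro mult_left_mono member_le_sum) auto
  finally show ?thesis .
qed (use assms in simp)

text \<open>For \<open>k \<le> n\<close> the bound is carried by the first summand, for larger
  \<open>k\<close> by the local average; adding the two gives one majorant for all orders in the
  chain rule.\<close>

lemma besov_density_compose_disc_moebius_le: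
  assumes a: "norm a < 1" and h: "h holomorphic_on ball 0 1" and p: "p > 0"
    and fin: "(\<integral>\<^sup>+w. besov_density p n ((deriv ^^ n) h) w \<partial>disc_lambda) < \<infinity>"
    and mn: "n \<le> m" "real (m - n) * p \<ge> 2" and k: "k \<le> m"
  shows "\<exists>C\<ge>0. \<forall>z\<in>ball 0 1.
    ennreal (((1 - (norm z)\<^sup>2) ^ m * norm ((deriv ^^ k) h (disc_moebius a z))) powr p)
    \<le> ennreal C * (ennreal ((1 - (norm z)\<^sup>2)\<^sup>2) +
        (\<integral>\<^sup>+w. besov_density p n ((deriv ^^ n) h) w * indicator {w. hyp_near a z w} w \<partial>disc_lambda))"
    (is "\<exists>C\<ge>0. \<forall>z\<in>ball 0 1. ?L z \<le> ennreal C * (?X z + ?A z)")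
proof (cases "k \<le> n")
  case True
  define \<delta> where "\<delta> = 1 - norm a"
  have \<delta>: "\<delta> > 0" using a by (simp add: \<delta>_def)
  obtain C where C: "C \<ge> 0" "\<And>z. z \<in> ball 0 1 \<Longrightarrow> norm ((deriv ^^ k) h z) \<le> C / (1 - norm z) ^ n"
    using besov_growth[OF h p fin True] by blast
  have "?L z \<le> ennreal ((C * (8 / \<delta>) ^ n) powr p) * (?X z + ?A z)" if z: "z \<in> ball 0 1" for z
  proof -
    define s where "s = 1 - (norm z)\<^sup>2"
    have s: "0 < s" "s \<le> 1" using one_minus_norm_bounds[OF z] by (simp_all add: s_def)
    define u where "u = disc_moebius a z"
    have u: "u \<in> ball 0 1" using disc_moebius_in_ball[OF a z] by (simp add: u_def)
    \<comment> \<open>The 8 is 4 from the distortion bound times 2 from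
      \<open>1 - (norm u)\<^sup>2 \<le> 2 * (1 - norm u)\<close>.\<close>
    have su: "\<delta> / 8 * s \<le> 1 - norm u"
      using one_minus_norm_disc_moebius_ge[OF a z] one_minus_norm_bounds[OF u] by (simp add: \<delta>_def s_def u_def)
    have "norm ((deriv ^^ k) h u) \<le> C / (1 - norm u) ^ n"
      using C u by blast
    also have "\<dots> \<le> C / (\<delta> / 8 * s) ^ n"
      using su \<delta> s C(1) u by (intro divide_left_mono power_mono mult_pos_pos zero_less_power) auto
    finally have "s ^ m * norm ((deriv ^^ k) h u) \<le> s ^ m * (C / (\<delta> / 8 * s) ^ n)"
      using s by (intro mult_left_mono) auto
    also have "s ^ m * (C / (\<delta> / 8 * s) ^ n) = s ^ (m - n) * s ^ n * (C / (\<delta> / 8 * s) ^ n)"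
      using mn by (simp flip: power_add)
    also have "\<dots> = C * (8 / \<delta>) ^ n * s ^ (m - n)"
      using s \<delta> by (simp add: power_mult_distrib power_divide field_simps)
    finally have "(s ^ m * norm ((deriv ^^ k) h u)) powr p \<le> (C * (8 / \<delta>) ^ n * s ^ (m - n)) powr p"
      using p s by (intro powr_mono2) auto
    also have "\<dots> = (C * (8 / \<delta>) ^ n) powr p * s powr (real (m - n) * p)"
      using s \<delta> C by (simp add: powr_mult powr_realpow[symmetric] powr_powr)
    \<comment> \<open>The growth bound has used up \<open>s ^ n\<close>. As \<open>s \<le> 1\<close>
      and the remaining exponent is at least 2, what is left is at most \<open>s\<^sup>2\<close>,
      the square that occurs in the density of \<open>disc_lambda\<close>.\<close>
    also have "s powr (real (m - n) * p) \<le> s powr 2"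
      using mn s by (intro powr_mono') auto
    also have "s powr 2 = s\<^sup>2" using s by simp
    finally have "(s ^ m * norm ((deriv ^^ k) h u)) powr p \<le> (C * (8 / \<delta>) ^ n) powr p * s\<^sup>2"
      by (simp add: mult_left_mono)
    then have "?L z \<le> ennreal ((C * (8 / \<delta>) ^ n) powr p) * ?X z"
      unfolding s_def u_def by (subst ennreal_mult'[symmetric]) (auto intro: ennreal_leI)
    also have "\<dots> \<le> ennreal ((C * (8 / \<delta>) ^ n) powr p) * (?X z + ?A z)"
      by (intro mult_left_mono) auto
    finally show ?thesis .
  qed
  then show ?thesis by (intro exI[of _ "(C * (8 / \<delta>) ^ n) powr p"]) auto
next
  case False
  define \<delta> where "\<delta> = 1 - norm a"
  have \<delta>: "\<delta> > 0" using a by (simp add: \<delta>_def)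
  define l where "l = k - n"
  have kl: "k = n + l" using False by (simp add: l_def)
  have hk: "(deriv ^^ l) ((deriv ^^ n) h) = (deriv ^^ k) h"
    by (simp add: kl add.commute[of n] funpow_add)
  have hn: "(deriv ^^ n) h holomorphic_on ball 0 1"
    using h by (intro holomorphic_higher_deriv) auto
  obtain C where C: "C > 0" "\<And>h z. h holomorphic_on ball 0 1 \<Longrightarrow> z \<in> ball 0 1 \<Longrightarrow>
    besov_density p (n + l) ((deriv ^^ l) h) z
      \<le> ennreal C * (\<integral>\<^sup>+w\<in>ball z ((1 - norm z) / 2). besov_density p n h w \<partial>disc_lambda)"
    using besov_density_deriv_le[OF p] by blast
  define K where "K = ((4 / \<delta>) ^ k) powr p"
  have "?L z \<le> ennreal (K * C) * (?X z + ?A z)" if z: "z \<in> ball 0 1" for z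
  proof -
    define s where "s = 1 - (norm z)\<^sup>2"
    have s: "0 < s" "s \<le> 1" using one_minus_norm_bounds[OF z] by (simp_all add: s_def)
    define u where "u = disc_moebius a z"
    have u: "u \<in> ball 0 1" using disc_moebius_in_ball[OF a z] by (simp add: u_def)
    define t where "t = 1 - (norm u)\<^sup>2"
    have t: "0 < t" using one_minus_norm_bounds[OF u] by (simp add: t_def)
    have "\<delta> / 4 * s \<le> t"
      using one_minus_norm_disc_moebius_ge[OF a z] by (simp add: \<delta>_def s_def u_def t_def)
    then have "s \<le> 4 / \<delta> * t" using \<delta> by (simp add: field_simps)
    then have "s ^ k \<le> (4 / \<delta> * t) ^ k" using s by (intro power_mono) auto
    \<comment> \<open>The weight at \<open>z\<close> is lowered from order \<open>m\<close> to
      \<open>k\<close>, the order that fits the derivative, and can then be exchanged for the weight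
      \<open>t\<close> at the image point.\<close>
    moreover have "s ^ m \<le> s ^ k" using s k by (intro power_decreasing) auto
    ultimately have "s ^ m \<le> (4 / \<delta>) ^ k * t ^ k"
      unfolding power_mult_distrib by (rule order_trans[rotated])
    then have "s ^ m * norm ((deriv ^^ k) h u) \<le> (4 / \<delta>) ^ k * t ^ k * norm ((deriv ^^ k) h u)"
      by (rule mult_right_mono) simp
    then have "s ^ m * norm ((deriv ^^ k) h u) \<le> (4 / \<delta>) ^ k * (t ^ k * norm ((deriv ^^ k) h u))"
      by (simp only: mult.assoc)
    then have "(s ^ m * norm ((deriv ^^ k) h u)) powr p \<le> ((4 / \<delta>) ^ k * (t ^ k * norm ((deriv ^^ k) h u))) powr p"
      using p s by (intro powr_mono2) auto
    also have "\<dots> = K * (t ^ k * norm ((deriv ^^ k) h u)) powr p"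
      using \<delta> t by (simp add: powr_mult K_def)
    finally have "?L z \<le> ennreal K * besov_density p k ((deriv ^^ k) h) u"
      using u unfolding besov_density_def s_def[symmetric] t_def[symmetric] u_def[symmetric]
      by (simp add: ennreal_mult'[symmetric] K_def ennreal_leI)
    also have "\<dots> \<le> ennreal K * (ennreal C * ?A z)"
      using C(2)[OF hn u] z unfolding hk kl[symmetric]
      by (intro mult_left_mono) (simp_all add: hyp_near_def u_def indicator_def)
    also have "\<dots> = ennreal (K * C) * ?A z"
      using C by (simp add: ennreal_mult K_def mult.assoc)
    also have "\<dots> \<le> ennreal (K * C) * (?X z + ?A z)"
      by (intro mult_left_mono) auto
    finally show ?thesis .
  qed
  then show ?thesis using C by (intro exI[of _ "K * C"]) (auto simp: K_def)
qed

lemma besov_compose_disc_moebius: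
  assumes a: "norm a < 1" and h: "h holomorphic_on ball 0 1" and p: "p > 0"
    and fin: "(\<integral>\<^sup>+w. besov_density p n ((deriv ^^ n) h) w \<partial>disc_lambda) < \<infinity>"
    and mn: "n \<le> m" "real (m - n) * p \<ge> 2"
  shows "(\<integral>\<^sup>+z. besov_density p m ((deriv ^^ m) (h \<circ> disc_moebius a)) z \<partial>disc_lambda) < \<infinity>"
proof -
  define \<Phi> where "\<Phi> = besov_density p n ((deriv ^^ n) h)"
  have \<Phi> [measurable]: "\<Phi> \<in> borel_measurable borel"
    unfolding \<Phi>_def using h p by (intro besov_density_measurable holomorphic_higher_deriv) auto
  define A where "A = (\<lambda>z. \<integral>\<^sup>+w. \<Phi> w * indicator {w. hyp_near a z w} w \<partial>disc_lambda)"
  have A [measurable]: "A \<in> borel_measurable borel"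
    and A_le: "(\<integral>\<^sup>+z. A z \<partial>disc_lambda) \<le> ennreal (144 / (1 - norm a) ^ 4) * (\<integral>\<^sup>+w. \<Phi> w \<partial>disc_lambda)"
    unfolding A_def by (rule hyp_near_average[OF a \<Phi>])+
  define X where "X z = ennreal ((1 - (norm z)\<^sup>2)\<^sup>2) * indicator (ball 0 1) z" for z :: complex
  have [measurable]: "ball 0 1 \<in> sets (borel :: complex measure)" by simp
  have X [measurable]: "X \<in> borel_measurable borel"
    unfolding X_def[abs_def] by measurable
  \<comment> \<open>The guard \<open>k \<le> m\<close> is inside the existential so that the choice
    principle yields one total function of constants.\<close>
  have "\<exists>c. k \<le> m \<longrightarrow> c \<ge> 0 \<and> (\<forall>z\<in>ball 0 1.
    ennreal (((1 - (norm z)\<^sup>2) ^ m * norm ((deriv ^^ k) h (disc_moebius a z))) powr p)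
    \<le> ennreal c * (X z + A z))" for k
  proof (cases "k \<le> m")
    case True
    have X: "X z = ennreal ((1 - (norm z)\<^sup>2)\<^sup>2)" if "z \<in> ball 0 1" for z
      using that by (simp add: X_def)
    obtain c where "c \<ge> 0" "\<forall>z\<in>ball 0 1.
      ennreal (((1 - (norm z)\<^sup>2) ^ m * norm ((deriv ^^ k) h (disc_moebius a z))) powr p)
      \<le> ennreal c * (ennreal ((1 - (norm z)\<^sup>2)\<^sup>2) + A z)"
      using besov_density_compose_disc_moebius_le[OF a h p fin mn True] unfolding A_def \<Phi>_def by blast
    then show ?thesis using X by (intro exI[of _ c]) (simp del: mem_ball)
  qed simp
  then have "\<exists>C. \<forall>k. k \<le> m \<longrightarrow> C k \<ge> 0 \<and> (\<forall>z\<in>ball 0 1.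
    ennreal (((1 - (norm z)\<^sup>2) ^ m * norm ((deriv ^^ k) h (disc_moebius a z))) powr p)
    \<le> ennreal (C k) * (X z + A z))"
    by (intro choice allI)
  then obtain C where C': "\<And>k. k \<le> m \<longrightarrow> C k \<ge> 0 \<and> (\<forall>z\<in>ball 0 1.
    ennreal (((1 - (norm z)\<^sup>2) ^ m * norm ((deriv ^^ k) h (disc_moebius a z))) powr p)
    \<le> ennreal (C k) * (X z + A z))"
    by blast
  have C: "\<And>k. k \<le> m \<Longrightarrow> C k \<ge> 0" "\<And>k z. k \<le> m \<Longrightarrow> z \<in> ball 0 1 \<Longrightarrow>
    ennreal (((1 - (norm z)\<^sup>2) ^ m * norm ((deriv ^^ k) h (disc_moebius a z))) powr p)
    \<le> ennreal (C k) * (X z + A z)"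
    using C' by blast+
  obtain P where P: "\<And>k. P k holomorphic_on {z. 1 - cnj a * z \<noteq> 0}"
    "\<And>z. z \<in> ball 0 1 \<Longrightarrow> (deriv ^^ m) (h \<circ> disc_moebius a) z = (\<Sum>k\<le>m. (deriv ^^ k) h (disc_moebius a z) * P k z)"
    using higher_deriv_compose_disc_moebius[OF a h, of m] by blast
  \<comment> \<open>The closed disc is compact and lies in the domain on which the coefficients are
    holomorphic.\<close>
  have "\<exists>M. \<forall>z\<in>cball 0 1. norm (P k z) \<le> M" for k
  proof -
    have "compact (P k ` cball 0 1)"
      using holomorphic_on_imp_continuous_on[OF P(1)] ball_subset_disc_moebius_domain[OF a]
      by (intro compact_continuous_image continuous_on_subset[OF holomorphic_on_imp_continuous_on[OF P(1)]]) auto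
    then show ?thesis
      by (auto dest!: compact_imp_bounded simp: bounded_iff)
  qed
  then obtain M where M: "\<And>k z. z \<in> cball 0 1 \<Longrightarrow> norm (P k z) \<le> M k" by metis
  define K where "K = real (Suc m) powr p * (\<Sum>k\<le>m. (M k powr p) * C k)"
  have M0: "M k \<ge> 0" for k using order_trans[OF norm_ge_zero M[of 0 k]] by simp
  have K: "K \<ge> 0" unfolding K_def using C by (intro mult_nonneg_nonneg sum_nonneg) auto
  have le: "besov_density p m ((deriv ^^ m) (h \<circ> disc_moebius a)) z \<le> ennreal K * (X z + A z)" for z
  proof (cases "z \<in> ball 0 1")
    case z: True
    define s where "s = 1 - (norm z)\<^sup>2"
    have s: "0 < s" "s \<le> 1" using one_minus_norm_bounds[OF z] by (simp_all add: s_def)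
    define F where "F k = norm ((deriv ^^ k) h (disc_moebius a z))" for k
    have F: "F k \<ge> 0" for k by (simp add: F_def)
    have "s ^ m * norm ((deriv ^^ m) (h \<circ> disc_moebius a) z) \<le> s ^ m * (\<Sum>k\<le>m. M k * F k)"
      unfolding P(2)[OF z] F_def using s M z
      by (intro mult_left_mono sum_norm_le) (auto simp: norm_mult mult.commute[of "M _"] intro!: mult_left_mono)
    also have "\<dots> = (\<Sum>k\<le>m. M k * (s ^ m * F k))"
      by (simp add: sum_distrib_left mult_ac)
    finally have "(s ^ m * norm ((deriv ^^ m) (h \<circ> disc_moebius a) z)) powr p \<le> (\<Sum>k\<le>m. M k * (s ^ m * F k)) powr p"
      using p s by (intro powr_mono2) auto
    also have "\<dots> \<le> real (card {..m}) powr p * (\<Sum>k\<le>m. (M k * (s ^ m * F k)) powr p)"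
      using p s M0 F by (intro powr_sum_le) auto
    also have "\<dots> = real (Suc m) powr p * (\<Sum>k\<le>m. M k powr p * (s ^ m * F k) powr p)"
      using s M0 F by (simp add: powr_mult)
    finally have "besov_density p m ((deriv ^^ m) (h \<circ> disc_moebius a)) z
        \<le> ennreal (real (Suc m) powr p * (\<Sum>k\<le>m. M k powr p * (s ^ m * F k) powr p))"
      using z by (simp add: besov_density_def s_def[symmetric] ennreal_leI)
    also have "\<dots> = ennreal (real (Suc m) powr p) * (\<Sum>k\<le>m. ennreal (M k powr p) * ennreal ((s ^ m * F k) powr p))"
      by (simp add: ennreal_mult' sum_ennreal[symmetric] sum_nonneg del: sum_ennreal of_nat_Suc)
    also have "\<dots> \<le> ennreal (real (Suc m) powr p) * (\<Sum>k\<le>m. ennreal (M k powr p) * (ennreal (C k) * (X z + A z)))"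
      using C(2)[OF _ z] by (intro mult_left_mono sum_mono) (auto simp: F_def s_def)
    also have "\<dots> = ennreal K * (X z + A z)"
    proof -
      have "ennreal K = ennreal (real (Suc m) powr p) * (\<Sum>k\<le>m. ennreal (M k powr p) * ennreal (C k))"
      proof -
        have "ennreal (\<Sum>k\<le>m. M k powr p * C k) = (\<Sum>k\<le>m. ennreal (M k powr p * C k))"
          using C(1) by (intro sum_ennreal[symmetric]) auto
        then show ?thesis
          unfolding K_def by (simp add: ennreal_mult' del: of_nat_Suc)
      qed
      then show ?thesis by (simp add: sum_distrib_right mult.assoc del: of_nat_Suc)
    qed
    finally show ?thesis .
  qed (simp add: besov_density_def)
  \<comment> \<open>\<open>X\<close> cancels the singular part of the density of
    \<open>disc_lambda\<close>, so only the area of the disc remains.\<close>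
  have "(\<integral>\<^sup>+z. X z \<partial>disc_lambda) \<le> (\<integral>\<^sup>+z. ennreal (1 / pi) * indicator (ball 0 1) z \<partial>(lborel::complex measure))"
    unfolding nn_integral_disc_lambda[OF X]
  proof (rule nn_integral_mono)
    fix z :: complex
    show "ennreal (indicator (ball 0 1) z / (pi * (1 - (norm z)\<^sup>2)\<^sup>2)) * X z \<le> ennreal (1 / pi) * indicator (ball 0 1) z"
      using one_minus_norm_bounds(4)[of z] by (auto simp: X_def indicator_def ennreal_mult'[symmetric] ennreal_mult''[symmetric])
  qed
  also have "\<dots> < \<infinity>"
    using emeasure_lborel_ball_finite[of "0::complex" 1]
    by (simp add: nn_integral_cmult_indicator ennreal_mult_less_top)
  finally have X_fin: "(\<integral>\<^sup>+z. X z \<partial>disc_lambda) < \<infinity>" .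
  have "(\<integral>\<^sup>+z. A z \<partial>disc_lambda) < \<infinity>"
    using fin by (intro le_less_trans[OF A_le]) (simp add: \<Phi>_def ennreal_mult_less_top)
  have "(\<integral>\<^sup>+z. besov_density p m ((deriv ^^ m) (h \<circ> disc_moebius a)) z \<partial>disc_lambda)
      \<le> (\<integral>\<^sup>+z. ennreal K * (X z + A z) \<partial>disc_lambda)"
    by (intro nn_integral_mono le)
  also have "\<dots> = ennreal K * ((\<integral>\<^sup>+z. X z \<partial>disc_lambda) + (\<integral>\<^sup>+z. A z \<partial>disc_lambda))"
    by (simp add: nn_integral_cmult nn_integral_add)
  also have "\<dots> < \<infinity>"
    using X_fin \<open>(\<integral>\<^sup>+z. A z \<partial>disc_lambda) < \<infinity>\<close> by (simp add: ennreal_mult_less_top)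
  finally show ?thesis .
qed

section \<open>Splitting along a slice\<close>

lemmas quat_defs = plus_quat_def minus_quat_def uminus_quat_def times_quat_def scaleR_quat_def
  zero_quat_def one_quat_def inner_quat_def of_real_def

lemma imag_unitsD:
  assumes "i \<in> imag_units"
  shows "qRe i = 0" "(qIm1 i)\<^sup>2 + (qIm2 i)\<^sup>2 + (qIm3 i)\<^sup>2 = 1" "norm i = 1" "i \<bullet> i = 1" "i * i = - 1"
proof -
  show 1: "qRe i = 0" "norm i = 1" using assms by (auto simp: imag_units_def)
  then show ii: "i \<bullet> i = 1" by (simp add: norm_eq_1)
  then show 2: "(qIm1 i)\<^sup>2 + (qIm2 i)\<^sup>2 + (qIm3 i)\<^sup>2 = 1"
    using 1 by (simp add: inner_quat_def power2_eq_square)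
  show "i * i = - 1"
    using 1 2 by (simp add: quat_eq_iff quat_defs power2_eq_square algebra_simps)
qed

lemma slice_embed_altdef: "slice_embed i z = Re z *\<^sub>R 1 + Im z *\<^sub>R i"
  by (simp add: slice_embed_def of_real_def)

lemma bounded_linear_slice_embed: "bounded_linear (slice_embed i)"
  unfolding slice_embed_altdef
  by (intro bounded_linear_add bounded_linear_scaleR_const bounded_linear_Re bounded_linear_Im)

lemma bounded_linear_quat:
  "linear f \<Longrightarrow> bounded_linear (f :: quat \<Rightarrow> 'b::real_normed_vector)"
  by (simp add: linear_conv_bounded_linear)

lemma quat_inner_mult_left: "(q * x) \<bullet> (q * y) = (q \<bullet> q) * (x \<bullet> y)" for q x y :: quat
  by (simp add: quat_defs algebra_simps)

lemma quat_inner_mult_right: "(x * q) \<bullet> (y * q) = (q \<bullet> q) * (x \<bullet> y)" for q x y :: quat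
  by (simp add: quat_defs algebra_simps)

lemma qRe_eq_inner: "qRe q = q \<bullet> 1"
  by (simp add: quat_defs)

definition quat_join :: "quat \<Rightarrow> quat \<Rightarrow> complex \<Rightarrow> complex \<Rightarrow> quat" where
  "quat_join i j u v = slice_embed i u + slice_embed i v * j"

text \<open>Components are coordinates in the frame \<open>1\<close>, \<open>i\<close>,
  \<open>j\<close>, \<open>i * j\<close>, which is orthonormal when \<open>i\<close> and
  \<open>j\<close> are orthogonal imaginary units. Unlike the definite descriptions in
  \<open>split_fst\<close> and \<open>split_snd\<close>, they are visibly linear in
  \<open>q\<close>.\<close>

definition quat_fst :: "quat \<Rightarrow> quat \<Rightarrow> complex" where
  "quat_fst i q = Complex (q \<bullet> 1) (q \<bullet> i)"

definition quat_snd :: "quat \<Rightarrow> quat \<Rightarrow> quat \<Rightarrow> complex" where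
  "quat_snd i j q = Complex (q \<bullet> j) (q \<bullet> (i * j))"

context
  fixes i :: quat
  assumes i: "i \<in> imag_units"
begin

lemma slice_embed_mult: "slice_embed i (z * w) = slice_embed i z * slice_embed i w"
proof -
  have "slice_embed i z * slice_embed i w
      = (Re z * Re w) *\<^sub>R 1 + (Re z * Im w + Im z * Re w) *\<^sub>R i + (Im z * Im w) *\<^sub>R (i * i)"
    by (simp add: slice_embed_altdef algebra_simps)
  then show ?thesis
    using imag_unitsD[OF i] by (simp add: slice_embed_altdef algebra_simps)
qed

lemma slice_embed_1 [simp]: "slice_embed i 1 = 1"
  and slice_embed_of_real: "slice_embed i (of_real r) = of_real r"
  and slice_embed_ii: "slice_embed i \<i> = i"
  by (simp_all add: slice_embed_def)

lemma slice_embed_power: "slice_embed i (z ^ n) = slice_embed i z ^ n"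
  by (induction n) (simp_all add: slice_embed_mult)

lemma norm_slice_embed: "norm (slice_embed i z) = norm z"
proof -
  have "(norm (slice_embed i z))\<^sup>2 = slice_embed i z \<bullet> slice_embed i z"
    by (simp add: power2_norm_eq_inner)
  also have "\<dots> = (Re z)\<^sup>2 + (Im z)\<^sup>2"
    using imag_unitsD[OF i] qRe_eq_inner[of i]
    by (simp add: slice_embed_altdef inner_simps inner_commute[of 1 i] power2_eq_square)
       (simp add: quat_defs)
  finally show ?thesis by (simp add: cmod_def flip: real_sqrt_unique)
qed

lemma slice_embed_in_slice_ball_iff: "slice_embed i z \<in> slice_ball i \<longleftrightarrow> z \<in> ball 0 1"
  by (auto simp: slice_ball_def slice_def norm_slice_embed)

text \<open>Commuting with \<open>i\<close> makes the cross product of the vector parts vanish (fact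
  \<open>c\<close>), so the vector part of \<open>w\<close> is a real multiple of
  \<open>i\<close>.\<close>

lemma commute_imp_slice:
  assumes "w * i = i * w"
  shows "w = slice_embed i (Complex (qRe w) (w \<bullet> i))"
proof -
  have n: "qIm1 i * qIm1 i + qIm2 i * qIm2 i + qIm3 i * qIm3 i = 1" "qRe i = 0"
    using imag_unitsD[OF i] by (auto simp: power2_eq_square)
  have c: "qIm2 w * qIm3 i = qIm3 w * qIm2 i" "qIm3 w * qIm1 i = qIm1 w * qIm3 i" "qIm1 w * qIm2 i = qIm2 w * qIm1 i"
    using assms n by (auto simp: quat_eq_iff quat_defs mult.commute)
  have "qIm1 w = (qIm1 w * qIm1 i + qIm2 w * qIm2 i + qIm3 w * qIm3 i) * qIm1 i"
    using n c by algebra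
  moreover have "qIm2 w = (qIm1 w * qIm1 i + qIm2 w * qIm2 i + qIm3 w * qIm3 i) * qIm2 i"
    using n c by algebra
  moreover have "qIm3 w = (qIm1 w * qIm1 i + qIm2 w * qIm2 i + qIm3 w * qIm3 i) * qIm3 i"
    using n c by algebra
  ultimately show ?thesis
    using n by (simp add: slice_embed_altdef quat_eq_iff quat_defs)
qed

context
  fixes j :: quat
  assumes j: "j \<in> imag_units" and ij: "i \<bullet> j = 0"
begin

lemma quat_anticommute: "j * i = - (i * j)"
proof -
  have "qRe i = 0" "qRe j = 0" using imag_unitsD[OF i] imag_unitsD[OF j] by auto
  then show ?thesis using ij by (simp add: quat_eq_iff quat_defs algebra_simps)
qed

lemma quat_frame:
  "i \<bullet> 1 = 0" "1 \<bullet> i = 0" "j \<bullet> 1 = 0" "1 \<bullet> j = 0" "j \<bullet> i = 0" "i \<bullet> j = 0" "(i * j) \<bullet> 1 = 0" "1 \<bullet> (i * j) = 0"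
  "i \<bullet> (i * j) = 0" "(i * j) \<bullet> i = 0" "j \<bullet> (i * j) = 0" "(i * j) \<bullet> j = 0"
  "i \<bullet> i = 1" "j \<bullet> j = 1" "(i * j) \<bullet> (i * j) = 1" "(1::quat) \<bullet> 1 = 1"
proof -
  have r: "qRe i = 0" "qRe j = 0" using imag_unitsD[OF i] imag_unitsD[OF j] by auto
  then show A: "i \<bullet> 1 = 0" "1 \<bullet> i = 0" "j \<bullet> 1 = 0" "1 \<bullet> j = 0"
    by (simp_all add: quat_defs)
  show "i \<bullet> j = 0" "j \<bullet> i = 0" using ij by (simp_all add: inner_commute)
  show ii: "i \<bullet> i = 1" "j \<bullet> j = 1" using imag_unitsD[OF i] imag_unitsD[OF j] by auto
  show one: "(1::quat) \<bullet> 1 = 1" by (simp add: quat_defs)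
  show "(i * j) \<bullet> 1 = 0" "1 \<bullet> (i * j) = 0"
    using r ij by (simp_all add: quat_defs)
  show "i \<bullet> (i * j) = 0" "(i * j) \<bullet> i = 0"
    using quat_inner_mult_left[of i 1 j] A by (simp_all add: inner_commute)
  show "j \<bullet> (i * j) = 0" "(i * j) \<bullet> j = 0"
    using quat_inner_mult_right[of 1 j i] A by (simp_all add: inner_commute)
  show "(i * j) \<bullet> (i * j) = 1"
    using quat_inner_mult_left[of i j j] ii by simp
qed

lemma quat_join_altdef:
  "quat_join i j u v = Re u *\<^sub>R 1 + Im u *\<^sub>R i + Re v *\<^sub>R j + Im v *\<^sub>R (i * j)"
  by (simp add: quat_join_def slice_embed_altdef algebra_simps)

lemma quat_fst_join [simp]: "quat_fst i (quat_join i j u v) = u"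
  and quat_snd_join [simp]: "quat_snd i j (quat_join i j u v) = v"
  by (simp_all add: quat_fst_def quat_snd_def quat_join_altdef inner_add_left quat_frame)

lemma quat_join_eq_iff [simp]: "quat_join i j u v = quat_join i j u' v' \<longleftrightarrow> u = u' \<and> v = v'"
  using quat_fst_join quat_snd_join by metis

lemma norm_quat_join: "(norm (quat_join i j u v))\<^sup>2 = (norm u)\<^sup>2 + (norm v)\<^sup>2"
  unfolding power2_norm_eq_inner[of "quat_join i j u v"] cmod_power2
  by (simp add: quat_join_altdef inner_add_left inner_add_right quat_frame power2_eq_square)

text \<open>Existence of the splitting: \<open>u\<close> is the part of \<open>q\<close> that
  commutes with \<open>i\<close>, and \<open>v * j\<close> is the part that anticommutes with it.
  Since \<open>j\<close> anticommutes with \<open>i\<close> as well, \<open>v\<close> commutes with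
  \<open>i\<close>, and \<open>commute_imp_slice\<close> places both in the slice.\<close>

lemma quat_join_collapse: "quat_join i j (quat_fst i q) (quat_snd i j q) = q"
proof -
  have ii: "i * i = -1" "j * j = -1" using imag_unitsD[OF i] imag_unitsD[OF j] by auto
  have ii': "i * (i * x) = - x" "x * i * i = - x" "x * j * j = - x" for x
    using ii by (simp_all add: mult.assoc) (simp flip: mult.assoc)
  define u where "u = (1/2) *\<^sub>R (q - i * q * i)"
  define v where "v = - ((1/2) *\<^sub>R (q + i * q * i) * j)"
  have "u * i = i * u"
    by (simp add: u_def algebra_simps) (simp add: mult.assoc[symmetric] ii ii')
  then have u: "u \<in> slice i" using commute_imp_slice unfolding slice_def by (metis rangeI)
  have ji: "x * j * i = - (x * i * j)" for x
    by (simp add: mult.assoc quat_anticommute)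
  have "v * i = i * v"
    by (simp add: v_def algebra_simps) (simp add: mult.assoc[symmetric] ii ii' ji)
  then have v: "v \<in> slice i" using commute_imp_slice unfolding slice_def by (metis rangeI)
  have "v * j = (1/2) *\<^sub>R (q + i * q * i)"
    by (simp only: v_def mult_minus_left ii' minus_minus)
  then have "u + v * j = (1/2) *\<^sub>R (q + q)"
    by (simp add: u_def scaleR_add_right scaleR_diff_right)
  then have "q = u + v * j"
    by (simp flip: scaleR_2)
  then obtain a b where "q = quat_join i j a b"
    using u v unfolding slice_def quat_join_def by auto
  then show ?thesis by simp
qed

lemma bounded_linear_quat_fst: "bounded_linear (quat_fst i)"
  by (rule bounded_linear_quat) (rule linearI; simp add: quat_fst_def complex_eq_iff inner_simps)

lemma bounded_linear_quat_snd: "bounded_linear (quat_snd i j)"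
  by (rule bounded_linear_quat) (rule linearI; simp add: quat_snd_def complex_eq_iff inner_simps)

lemma quat_join_mult: "slice_embed i h * quat_join i j u v = quat_join i j (h * u) (h * v)"
  by (simp add: quat_join_def slice_embed_mult algebra_simps)

lemma quat_fst_mult: "quat_fst i (slice_embed i h * q) = h * quat_fst i q"
  and quat_snd_mult: "quat_snd i j (slice_embed i h * q) = h * quat_snd i j q"
  using quat_join_mult[of h "quat_fst i q" "quat_snd i j q"] by (simp_all add: quat_join_collapse)

text \<open>Left multiplication by a slice element is the quaternionic form of complex linearity;
  holomorphy is passed to the extension lemmas in this shape.\<close>

lemma has_derivative_quat_join:
  assumes "(A has_field_derivative A') (at z)" "(B has_field_derivative B') (at z)"
  shows "((\<lambda>z. quat_join i j (A z) (B z)) has_derivative (\<lambda>h. slice_embed i h * quat_join i j A' B')) (at z)"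
proof -
  have "((\<lambda>z. slice_embed i (A z) + slice_embed i (B z) * j) has_derivative
      (\<lambda>h. slice_embed i (A' * h) + slice_embed i (B' * h) * j)) (at z)"
    using assms
    by (intro has_derivative_add has_derivative_mult_left bounded_linear.has_derivative[OF bounded_linear_slice_embed])
       (simp_all add: has_field_derivative_def)
  then show ?thesis
    by (simp add: quat_join_def[abs_def] distrib_left slice_embed_mult[symmetric] mult.assoc[symmetric] mult.commute)
qed

text \<open>Adding a real number does not leave the slice, so the values of \<open>g\<close> on it
  determine the derivative. The conclusion has the form of the hypothesis on \<open>g\<close>, so
  the rule can be iterated.\<close>

lemma deriv_x0_quat_join:
  assumes A: "A holomorphic_on ball 0 1" and B: "B holomorphic_on ball 0 1"
    and g: "\<And>z. z \<in> ball 0 1 \<Longrightarrow> g (slice_embed i z) = quat_join i j (A z) (B z)"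
    and z: "z \<in> ball 0 1"
  shows "deriv_x0 g (slice_embed i z) = quat_join i j (deriv A z) (deriv B z)"
proof -
  have d: "((\<lambda>z. quat_join i j (A z) (B z)) has_derivative (\<lambda>h. slice_embed i h * quat_join i j (deriv A z) (deriv B z))) (at z)"
    using A B z by (intro has_derivative_quat_join holomorphic_derivI) auto
  have l: "((\<lambda>t. z + of_real t) has_derivative of_real) (at (0::real))"
    by (auto intro!: derivative_eq_intros)
  have "((\<lambda>t. quat_join i j (A (z + of_real t)) (B (z + of_real t))) has_derivative
      (\<lambda>t. slice_embed i (of_real t) * quat_join i j (deriv A z) (deriv B z))) (at (0::real))"
    using has_derivative_compose[OF l, of "\<lambda>z. quat_join i j (A z) (B z)"] d by simp
  then have "((\<lambda>t. quat_join i j (A (z + of_real t)) (B (z + of_real t))) has_vector_derivative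
      quat_join i j (deriv A z) (deriv B z)) (at (0::real))"
    unfolding has_vector_derivative_def by (simp add: slice_embed_of_real scaleR_conv_of_real)
  moreover have "open ((\<lambda>t::real. z + of_real t) -` ball 0 1)"
    by (intro open_vimage continuous_intros) auto
  ultimately have "((\<lambda>t. g (slice_embed i z + of_real t)) has_vector_derivative
      quat_join i j (deriv A z) (deriv B z)) (at (0::real))"
    using z
  proof (elim has_vector_derivative_transform_within_open)
    fix t :: real assume "t \<in> (\<lambda>t. z + of_real t) -` ball 0 1"
    then show "quat_join i j (A (z + of_real t)) (B (z + of_real t)) = g (slice_embed i z + of_real t)"
      using g[of "z + of_real t"] by (simp add: slice_embed_def add_ac)
  qed auto
  then show ?thesis
    unfolding deriv_x0_def by (rule vector_derivative_at)
qed

lemma deriv_x0_funpow_quat_join: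
  assumes A: "A holomorphic_on ball 0 1" and B: "B holomorphic_on ball 0 1"
    and g: "\<And>z. z \<in> ball 0 1 \<Longrightarrow> g (slice_embed i z) = quat_join i j (A z) (B z)"
    and z: "z \<in> ball 0 1"
  shows "(deriv_x0 ^^ n) g (slice_embed i z) = quat_join i j ((deriv ^^ n) A z) ((deriv ^^ n) B z)"
  using z
proof (induction n arbitrary: z)
  case (Suc n)
  show ?case
    using deriv_x0_quat_join[of "(deriv ^^ n) A" "(deriv ^^ n) B" "(deriv_x0 ^^ n) g", OF _ _ Suc.IH Suc.prems] A B
    by (simp add: holomorphic_higher_deriv)
qed (simp add: g)

text \<open>The splitting lemma. The slice equation turns the real derivative into left
  multiplication by the slice, and both component maps are linear over such multiplication.\<close>

lemma slice_regular_imp_quat_join: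
  assumes f: "f \<in> slice_regular"
  obtains A B where "A holomorphic_on ball 0 1" "B holomorphic_on ball 0 1"
    "\<And>z. z \<in> ball 0 1 \<Longrightarrow> f (slice_embed i z) = quat_join i j (A z) (B z)"
proof
  let ?G = "\<lambda>z. f (slice_embed i z)"
  have D: "\<exists>D. (?G has_derivative (\<lambda>h. slice_embed i h * D)) (at z)" if z: "z \<in> ball 0 1" for z
  proof -
    have "f differentiable (at (slice_embed i z))"
      using f z unfolding slice_regular_def
      by (auto simp: differentiable_on_eq_differentiable_at norm_slice_embed)
    then have "?G differentiable (at z)"
      by (rule differentiable_compose) (rule bounded_linear_imp_differentiable[OF bounded_linear_slice_embed])
    then obtain L where L: "(?G has_derivative L) (at z)" by (auto simp: differentiable_def)
    have lin: "linear L" using L has_derivative_linear by blast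
    have "((\<lambda>t. Complex t (Im z)) has_derivative of_real) (at (Re z))"
      unfolding Complex_eq by (auto intro!: derivative_eq_intros)
    from has_derivative_compose[OF this, of ?G L]
    have "((\<lambda>t. ?G (Complex t (Im z))) has_derivative (\<lambda>t. L (of_real t))) (at (Re z))"
      using L by simp
    then have "((\<lambda>t. f (of_real t + i * of_real (Im z))) has_vector_derivative L 1) (at (Re z))"
      using linear_scale[OF lin, of _ 1]
      by (simp add: has_vector_derivative_def slice_embed_def scaleR_conv_of_real)
    note x = vector_derivative_at[OF this]
    have "((\<lambda>t. Complex (Re z) t) has_derivative (\<lambda>t. t *\<^sub>R \<i>)) (at (Im z))"
      unfolding Complex_eq by (auto intro!: derivative_eq_intros simp: scaleR_conv_of_real)
    from has_derivative_compose[OF this, of ?G L]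
    have "((\<lambda>t. ?G (Complex (Re z) t)) has_derivative (\<lambda>t. L (t *\<^sub>R \<i>))) (at (Im z))"
      using L by simp
    then have "((\<lambda>t. f (of_real (Re z) + i * of_real t)) has_vector_derivative L \<i>) (at (Im z))"
      using linear_scale[OF lin, of _ \<i>]
      by (simp add: has_vector_derivative_def slice_embed_def)
    note y = vector_derivative_at[OF this]
    have "slice_embed i z \<in> ball 0 1" using z by (simp add: norm_slice_embed)
    then have "of_real (Re z) + i * of_real (Im z) \<in> ball 0 1" by (simp only: slice_embed_def)
    then have "vector_derivative (\<lambda>t. f (of_real t + i * of_real (Im z))) (at (Re z))
       + i * vector_derivative (\<lambda>t. f (of_real (Re z) + i * of_real t)) (at (Im z)) = 0"
      using f i unfolding slice_regular_def by blast
    then have "L 1 + i * L \<i> = 0" unfolding x y .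
    \<comment> \<open>Multiplying the Cauchy-Riemann equation by \<open>i\<close> solves it for
      \<open>L \<i>\<close>, and real linearity then determines \<open>L\<close> from
      \<open>L 1\<close>.\<close>
    then have "i * (L 1 + i * L \<i>) = 0" by simp
    then have "i * L 1 + (i * i) * L \<i> = 0" by (simp only: distrib_left mult.assoc)
    then have "L \<i> = i * L 1"
      using imag_unitsD[OF i] by (simp add: algebra_simps)
    have "L h = slice_embed i h * L 1" for h
    proof -
      have "L h = L (Re h *\<^sub>R 1 + Im h *\<^sub>R \<i>)"
        by (rule arg_cong[of _ _ L]) (simp add: complex_eq_iff)
      also have "\<dots> = Re h *\<^sub>R L 1 + Im h *\<^sub>R L \<i>"
        using lin by (simp only: linear_add linear_scale)
      finally show ?thesis
        using \<open>L \<i> = i * L 1\<close> by (simp add: slice_embed_altdef algebra_simps)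
    qed
    then have "L = (\<lambda>h. slice_embed i h * L 1)" by (rule ext)
    with L have "(?G has_derivative (\<lambda>h. slice_embed i h * L 1)) (at z)" by (rule has_derivative_eq_rhs)
    then show ?thesis by blast
  qed
  show "f (slice_embed i z) = quat_join i j (quat_fst i (?G z)) (quat_snd i j (?G z))" for z
    by (simp add: quat_join_collapse)
  have "\<exists>d. ((\<lambda>z. quat_fst i (?G z)) has_field_derivative d) (at z)" if z: "z \<in> ball 0 1" for z
  proof -
    obtain D where "(?G has_derivative (\<lambda>h. slice_embed i h * D)) (at z)" using D[OF z] by blast
    from bounded_linear.has_derivative[OF bounded_linear_quat_fst this]
    have "((\<lambda>z. quat_fst i (?G z)) has_field_derivative quat_fst i D) (at z)"
      by (simp add: has_field_derivative_def quat_fst_mult mult.commute[of _ "quat_fst i D"])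
    then show ?thesis by blast
  qed
  then show "(\<lambda>z. quat_fst i (?G z)) holomorphic_on ball 0 1"
    by (simp add: holomorphic_on_open)
  have "\<exists>d. ((\<lambda>z. quat_snd i j (?G z)) has_field_derivative d) (at z)" if z: "z \<in> ball 0 1" for z
  proof -
    obtain D where "(?G has_derivative (\<lambda>h. slice_embed i h * D)) (at z)" using D[OF z] by blast
    from bounded_linear.has_derivative[OF bounded_linear_quat_snd this]
    have "((\<lambda>z. quat_snd i j (?G z)) has_field_derivative quat_snd i j D) (at z)"
      by (simp add: has_field_derivative_def quat_snd_mult mult.commute[of _ "quat_snd i j D"])
    then show ?thesis by blast
  qed
  then show "(\<lambda>z. quat_snd i j (?G z)) holomorphic_on ball 0 1"
    by (simp add: holomorphic_on_open)
qed

end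

end

section \<open>Slice regular extension\<close>

definition slice_coord :: "quat \<Rightarrow> complex" where
  "slice_coord q = Complex (qRe q) (norm (qvec q))"

text \<open>\<open>slice_extend\<close> with the slice function pulled back to the complex plane
  (see \<open>slice_extend_eq\<close>), where complex differentiability is available.\<close>

definition slice_ext :: "quat \<Rightarrow> (complex \<Rightarrow> quat) \<Rightarrow> quat \<Rightarrow> quat" where
  "slice_ext i G q = ((1 + sgn (qvec q) * i) * G (cnj (slice_coord q))
     + (1 - sgn (qvec q) * i) * G (slice_coord q)) /\<^sub>R 2"

lemma quat_eq_re_vec: "q = of_real (qRe q) + qvec q"
  by (simp add: quat_eq_iff quat_defs qvec_def)

lemma qRe_diff_of_real: "qRe (q - of_real x) = qRe q - x"
  and qvec_diff_of_real: "qvec (q - of_real x) = qvec q"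
  by (simp_all add: quat_eq_iff quat_defs qvec_def)

lemma linear_qRe: "linear qRe"
  by (rule linearI) (simp_all add: quat_defs)

lemma linear_qvec: "linear qvec"
  by (rule linearI) (simp_all add: quat_eq_iff quat_defs qvec_def)

lemma norm_quat_eq: "(norm q)\<^sup>2 = (qRe q)\<^sup>2 + (norm (qvec q))\<^sup>2"
  unfolding power2_norm_eq_inner by (simp add: quat_defs qvec_def power2_eq_square)

text \<open>Distances to real points survive the passage to \<open>slice_coord\<close>; this
  transfers the error estimate at a real point from the slice to all directions.\<close>

lemma norm_slice_coord_diff: "norm (slice_coord q - of_real x) = norm (q - of_real x)"
proof -
  have "(norm (slice_coord q - of_real x))\<^sup>2 = (norm (q - of_real x))\<^sup>2"
    unfolding norm_quat_eq[of "q - of_real x"] cmod_power2 qRe_diff_of_real qvec_diff_of_real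
    by (simp add: slice_coord_def)
  then show ?thesis by (rule power2_eq_imp_eq) simp_all
qed

lemma norm_slice_coord: "norm (slice_coord q) = norm q"
  using norm_slice_coord_diff[of q 0] by simp

lemma norm_cnj_diff_of_real: "norm (cnj z - of_real x) = norm (z - of_real x)"
  using complex_mod_cnj[of "z - of_real x"] by simp

lemma slice_coord_in_ball: "slice_coord q \<in> ball 0 1 \<longleftrightarrow> q \<in> ball 0 1"
  by (simp add: norm_slice_coord)

text \<open>On the slice through \<open>I\<close> the extension has the same form for both signs of the imaginary
  part, because the two summands change roles under \<open>(I, y) \<mapsto> (- I, - y)\<close>.\<close>

lemma slice_ext_on_slice:
  assumes I: "I \<in> imag_units"
  shows "slice_ext i G (slice_embed I z)
    = ((1 + I * i) * G (cnj z) + (1 - I * i) * G z) /\<^sub>R 2"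
proof -
  have re: "qRe (slice_embed I z) = Re z" and vec: "qvec (slice_embed I z) = Im z *\<^sub>R I"
    using imag_unitsD(1)[OF I] by (simp_all add: slice_embed_altdef quat_eq_iff quat_defs qvec_def)
  have sg: "sgn (qvec (slice_embed I z)) = sgn (Im z) *\<^sub>R I"
    unfolding vec using imag_unitsD(3)[OF I] by (simp add: sgn_div_norm real_sgn_eq)
  have co: "slice_coord (slice_embed I z) = Complex (Re z) \<bar>Im z\<bar>"
    unfolding slice_coord_def re vec using imag_unitsD(3)[OF I] by simp
  have co': "cnj (slice_coord (slice_embed I z)) = Complex (Re z) (- \<bar>Im z\<bar>)"
    unfolding co by (simp add: complex_eq_iff)
  consider "Im z > 0" | "Im z = 0" | "Im z < 0" by linarith
  then show ?thesis
  proof cases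
    case 1
    then have "Complex (Re z) \<bar>Im z\<bar> = z" "Complex (Re z) (- \<bar>Im z\<bar>) = cnj z"
      by (simp_all add: complex_eq_iff)
    with 1 show ?thesis unfolding slice_ext_def sg co co' by simp
  next
    case 2
    then have "Complex (Re z) \<bar>Im z\<bar> = z" "Complex (Re z) (- \<bar>Im z\<bar>) = z" "cnj z = z"
      by (simp_all add: complex_eq_iff)
    with 2 show ?thesis unfolding slice_ext_def sg co co' by (simp add: algebra_simps)
  next
    case 3
    then have "Complex (Re z) \<bar>Im z\<bar> = cnj z" "Complex (Re z) (- \<bar>Im z\<bar>) = z"
      by (simp_all add: complex_eq_iff)
    with 3 show ?thesis unfolding slice_ext_def sg co co' by (simp add: add.commute)
  qed
qed

text \<open>Off the real axis \<open>norm (qvec q)\<close> and \<open>sgn (qvec q)\<close> are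
  differentiable, so the defining formula can be differentiated term by term.\<close>

lemma slice_ext_differentiable_at_nonreal:
  assumes G: "\<And>z. z \<in> ball 0 1 \<Longrightarrow> G differentiable (at z)"
    and q: "q \<in> ball 0 1" "qvec q \<noteq> 0"
  shows "slice_ext i G differentiable (at q)"
proof -
  have re: "qRe differentiable (at q)"
    by (intro bounded_linear_imp_differentiable bounded_linear_quat linear_qRe)
  have vec: "qvec differentiable (at q)"
    by (intro bounded_linear_imp_differentiable bounded_linear_quat linear_qvec)
  have nv: "(\<lambda>q. norm (qvec q)) differentiable (at q)"
    by (rule differentiable_compose[OF differentiable_norm_at vec]) (use q in auto)
  have sg: "(\<lambda>q. sgn (qvec q)) differentiable (at q)"
    unfolding sgn_div_norm
    by (intro differentiable_scaleR differentiable_inverse nv vec) (use q in auto)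
  have co: "slice_coord differentiable (at q)"
    unfolding slice_coord_def[abs_def] Complex_eq
    by (intro differentiable_add differentiable_mult differentiable_const
        differentiable_compose[OF bounded_linear_imp_differentiable[OF bounded_linear_of_real]] re nv)
  have cco: "(\<lambda>q. cnj (slice_coord q)) differentiable (at q)"
    by (rule differentiable_compose[OF bounded_linear_imp_differentiable[OF bounded_linear_cnj] co])
  have b: "slice_coord q \<in> ball 0 1" "cnj (slice_coord q) \<in> ball 0 1"
    using q slice_coord_in_ball by auto
  have "(\<lambda>q. G (slice_coord q)) differentiable (at q)" "(\<lambda>q. G (cnj (slice_coord q))) differentiable (at q)"
    using differentiable_compose[OF G[OF b(1)] co] differentiable_compose[OF G[OF b(2)] cco] by auto
  then show ?thesis
    unfolding slice_ext_def[abs_def] using sg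
    by (intro differentiable_scaleR differentiable_add differentiable_diff differentiable_mult differentiable_const)
qed

lemma norm_one_add_sgn_mult:
  fixes v i :: quat
  assumes "norm i = 1"
  shows "norm (1 + sgn v * i) \<le> 2" "norm (1 - sgn v * i) \<le> 2"
proof -
  have "norm (sgn v * i) \<le> 1"
    using assms by (simp add: norm_mult norm_sgn)
  then show "norm (1 + sgn v * i) \<le> 2" "norm (1 - sgn v * i) \<le> 2"
    using norm_triangle_ineq[of 1 "sgn v * i"] norm_triangle_ineq4[of 1 "sgn v * i"] by auto
qed

text \<open>The extension reproduces affine functions with real base point, because the terms
  containing the product of the two units collapse through \<open>i * i = - 1\<close>. Thus the
  linearisation of \<open>G\<close> extends to the linearisation of its extension.\<close>

lemma slice_ext_linear_part:
  assumes "i \<in> imag_units"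
  shows "slice_ext i (\<lambda>z. c + slice_embed i (z - of_real x) * d) q = c + (q - of_real x) * d"
proof -
  define I where "I = sgn (qvec q)"
  define X Y where "X = qRe q - x" and "Y = norm (qvec q)"
  have ii: "i * i = - 1" using imag_unitsD[OF assms] by simp
  have "Y *\<^sub>R I = qvec q"
    by (cases "qvec q = 0") (simp_all add: I_def Y_def sgn_div_norm)
  have q: "q - of_real x = X *\<^sub>R 1 + Y *\<^sub>R I"
    unfolding \<open>Y *\<^sub>R I = qvec q\<close> by (subst quat_eq_re_vec[of q]) (simp add: X_def of_real_def algebra_simps)
  have "slice_ext i (\<lambda>z. c + slice_embed i (z - of_real x) * d) q
      = ((1 + I * i) * (c + (X *\<^sub>R 1 - Y *\<^sub>R i) * d) + (1 - I * i) * (c + (X *\<^sub>R 1 + Y *\<^sub>R i) * d)) /\<^sub>R 2"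
    by (simp add: slice_ext_def slice_embed_altdef slice_coord_def I_def X_def Y_def)
  also have "\<dots> = c + (X *\<^sub>R 1 - Y *\<^sub>R (I * (i * i))) * d"
    by (simp add: algebra_simps) (simp flip: scaleR_2 add: mult.assoc)
  finally show ?thesis unfolding q ii by simp
qed

lemma slice_ext_has_derivative_at_real:
  assumes i: "i \<in> imag_units"
    and G: "(G has_derivative (\<lambda>h. slice_embed i h * d)) (at (of_real x))"
  shows "(slice_ext i G has_derivative (\<lambda>h. h * d)) (at (of_real x))"
  unfolding has_derivative_at_alt
proof (intro conjI allI impI)
  show "bounded_linear (\<lambda>h. h * d)" by (rule bounded_linear_mult_left)
  fix e :: real assume "e > 0"
  \<comment> \<open>Each factor \<open>1 + I * i\<close>, \<open>1 - I * i\<close> has norm at most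
    2, there are two terms, and the sum is halved; an error of \<open>e / 2\<close> for
    \<open>G\<close> becomes \<open>e\<close>.\<close>
  then obtain \<delta> where \<delta>: "\<delta> > 0" "\<And>z. norm (z - of_real x) < \<delta> \<Longrightarrow>
      norm (G z - G (of_real x) - slice_embed i (z - of_real x) * d) \<le> e / 2 * norm (z - of_real x)"
    using G unfolding has_derivative_at_alt by (meson half_gt_zero)
  have "norm (slice_ext i G q - slice_ext i G (of_real x) - (q - of_real x) * d) \<le> e * norm (q - of_real x)"
    if q: "norm (q - of_real x) < \<delta>" for q
  proof -
    define k where "k z = G z - (G (of_real x) + slice_embed i (z - of_real x) * d)" for z
    let ?z = "slice_coord q" and ?I = "sgn (qvec q)" and ?r = "norm (q - of_real x)"
    have k: "norm (k ?z) \<le> e / 2 * ?r" "norm (k (cnj ?z)) \<le> e / 2 * ?r"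
      using \<delta>(2)[of ?z] \<delta>(2)[of "cnj ?z"] q
      unfolding norm_cnj_diff_of_real norm_slice_coord_diff k_def by (simp_all add: algebra_simps)
    have x: "slice_ext i G (of_real x) = G (of_real x)"
      using slice_ext_on_slice[OF i, of i G "of_real x"]
      by (simp add: slice_embed_of_real[OF i] algebra_simps flip: scaleR_2)
    have "slice_ext i G q - (G (of_real x) + (q - of_real x) * d)
       = slice_ext i G q - slice_ext i (\<lambda>z. G (of_real x) + slice_embed i (z - of_real x) * d) q"
      by (simp add: slice_ext_linear_part[OF i])
    also have "\<dots> = ((1 + ?I * i) * k (cnj ?z) + (1 - ?I * i) * k ?z) /\<^sub>R 2"
      unfolding slice_ext_def k_def by (simp only: right_diff_distrib scaleR_diff_right[symmetric]) (simp add: algebra_simps)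
    also have "norm \<dots> \<le> (2 * (e / 2 * ?r) + 2 * (e / 2 * ?r)) / 2"
    proof -
      have "norm ((1 + ?I * i) * k (cnj ?z) + (1 - ?I * i) * k ?z) \<le> 2 * (e / 2 * ?r) + 2 * (e / 2 * ?r)"
        by (rule norm_triangle_le, rule add_mono; unfold norm_mult)
           (rule mult_mono k norm_one_add_sgn_mult imag_unitsD(3)[OF i] norm_ge_zero zero_le_numeral)+
      then show ?thesis by simp
    qed
    finally show ?thesis unfolding x by (simp add: algebra_simps)
  qed
  then show "\<exists>d'>0. \<forall>y. norm (y - of_real x) < d' \<longrightarrow>
      norm (slice_ext i G y - slice_ext i G (of_real x) - (y - of_real x) * d) \<le> e * norm (y - of_real x)"
    using \<delta>(1) by blast
qed

text \<open>Differentiability is proved separately on and off the real axis. The slice equation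
  holds because the factors intertwine the two units:
  \<open>(1 + I * i) * (- i) = I * (1 + I * i)\<close> and
  \<open>(1 - I * i) * i = I * (1 - I * i)\<close>.\<close>

lemma slice_ext_slice_regular:
  assumes i: "i \<in> imag_units"
    and G: "\<And>z. z \<in> ball 0 1 \<Longrightarrow> (G has_derivative (\<lambda>h. slice_embed i h * D z)) (at z)"
    and g: "\<And>q. q \<in> ball 0 1 \<Longrightarrow> g q = slice_ext i G q"
  shows "g \<in> slice_regular"
  unfolding slice_regular_def
proof (intro CollectI conjI ballI allI impI)
  have diff: "slice_ext i G differentiable (at q)" if q: "q \<in> ball 0 1" for q
  proof (cases "qvec q = 0")
    case True
    then have q': "q = of_real (qRe q)" using quat_eq_re_vec[of q] by simp
    then have "norm (of_real (qRe q) :: quat) < 1" using q by simp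
    then have "complex_of_real (qRe q) \<in> ball 0 1" by simp
    from slice_ext_has_derivative_at_real[OF i G[OF this]] q' show ?thesis
      unfolding differentiable_def by metis
  next
    case False
    then show ?thesis using G q
      by (intro slice_ext_differentiable_at_nonreal) (auto simp: differentiable_def)
  qed
  show "g differentiable_on ball 0 1"
    unfolding differentiable_on_def
  proof
    fix q :: quat assume q: "q \<in> ball 0 1"
    then show "g differentiable (at q within ball 0 1)"
      by (intro differentiable_transform_within[OF differentiable_at_withinI[OF diff[OF q]] zero_less_one])
         (simp_all only: g)
  qed
next
  fix I :: quat and x y :: real
  assume I: "I \<in> imag_units" and xy: "of_real x + I * of_real y \<in> ball 0 1"
  define z where "z = Complex x y"
  \<comment> \<open>By \<open>slice_ext_on_slice\<close> this expression is valid for both signs of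
    the imaginary part, so it can be differentiated across the real axis.\<close>
  define E where "E w = ((1 + I * i) * G (cnj w) + (1 - I * i) * G w) /\<^sub>R 2" for w
  have emb: "slice_embed I (Complex s t) = of_real s + I * of_real t" for s t
    by (simp add: slice_embed_def)
  have gE: "g (slice_embed I w) = E w" if "w \<in> ball 0 1" for w
    using g[of "slice_embed I w"] that by (simp add: norm_slice_embed[OF I] slice_ext_on_slice[OF I] E_def)
  have zb: "z \<in> ball 0 1"
    using xy norm_slice_embed[OF I, of z] by (simp add: z_def emb)
  then have czb: "cnj z \<in> ball 0 1" by simp
  define L where "L h = ((1 + I * i) * (slice_embed i (cnj h) * D (cnj z))
      + (1 - I * i) * (slice_embed i h * D z)) /\<^sub>R 2" for h
  have "((\<lambda>w. G (cnj w)) has_derivative (\<lambda>h. slice_embed i (cnj h) * D (cnj z))) (at z)"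
    by (rule has_derivative_compose[OF bounded_linear_imp_has_derivative[OF bounded_linear_cnj] G[OF czb]])
  then have E: "(E has_derivative L) (at z)"
    unfolding E_def[abs_def] L_def[abs_def] using G[OF zb]
    by (intro has_derivative_scaleR_right has_derivative_add has_derivative_mult_right)
  have op: "open (ball (0::complex) 1)" by simp
  have "((\<lambda>t. Complex t y) has_derivative (\<lambda>t. t *\<^sub>R 1)) (at x)"
    unfolding Complex_eq by (auto intro!: derivative_eq_intros simp: scaleR_conv_of_real)
  from has_derivative_compose[OF this, of E L]
  have "((\<lambda>t. E (Complex t y)) has_derivative (\<lambda>t. L (t *\<^sub>R 1))) (at x)"
    using E by (simp add: z_def)
  then have 1: "((\<lambda>t. E (Complex t y)) has_vector_derivative L 1) (at x)"
    using linear_scale[OF has_derivative_linear[OF E], of _ 1]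
    by (simp add: has_vector_derivative_def)
  have "((\<lambda>t. g (of_real t + I * of_real y)) has_vector_derivative L 1) (at x)"
  proof (rule has_vector_derivative_transform_within_open[OF 1])
    show "open ((\<lambda>t. Complex t y) -` ball 0 1)"
      unfolding Complex_eq by (intro open_vimage continuous_intros) auto
    show "E (Complex t y) = g (of_real t + I * of_real y)" if "t \<in> (\<lambda>t. Complex t y) -` ball 0 1" for t
      using gE[of "Complex t y"] that by (simp add: emb)
  qed (use zb in \<open>simp add: z_def\<close>)
  note vx = vector_derivative_at[OF this]
  have "((\<lambda>t. Complex x t) has_derivative (\<lambda>t. t *\<^sub>R \<i>)) (at y)"
    unfolding Complex_eq by (auto intro!: derivative_eq_intros simp: scaleR_conv_of_real)
  from has_derivative_compose[OF this, of E L]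
  have "((\<lambda>t. E (Complex x t)) has_derivative (\<lambda>t. L (t *\<^sub>R \<i>))) (at y)"
    using E by (simp add: z_def)
  then have 2: "((\<lambda>t. E (Complex x t)) has_vector_derivative L \<i>) (at y)"
    using linear_scale[OF has_derivative_linear[OF E], of _ \<i>]
    by (simp add: has_vector_derivative_def)
  have "((\<lambda>t. g (of_real x + I * of_real t)) has_vector_derivative L \<i>) (at y)"
  proof (rule has_vector_derivative_transform_within_open[OF 2])
    show "open ((\<lambda>t. Complex x t) -` ball 0 1)"
      unfolding Complex_eq by (intro open_vimage continuous_intros) auto
    show "E (Complex x t) = g (of_real x + I * of_real t)" if "t \<in> (\<lambda>t. Complex x t) -` ball 0 1" for t
      using gE[of "Complex x t"] that by (simp add: emb)
  qed (use zb in \<open>simp add: z_def\<close>)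
  note vy = vector_derivative_at[OF this]
  have II: "I * (I * w) = - w" "i * (i * w) = - w" for w
    using imag_unitsD(5)[OF I] imag_unitsD(5)[OF i] by (simp_all flip: mult.assoc)
  have c: "slice_embed i (cnj \<i>) = - i" "slice_embed i (cnj 1) = 1"
    by (simp_all add: slice_embed_def)
  \<comment> \<open>The intertwining relations say that \<open>L \<i> = I * L 1\<close>; multiplying
    by \<open>I\<close> gives the equation.\<close>
  have "I * L \<i> = - L 1"
    unfolding L_def c slice_embed_ii[OF i] slice_embed_1[OF i]
    by (simp add: algebra_simps II)
  then show "vector_derivative (\<lambda>t. g (of_real t + I * of_real y)) (at x)
       + I * vector_derivative (\<lambda>t. g (of_real x + I * of_real t)) (at y) = 0"
    unfolding vx vy by simp
qed

section \<open>Composition with the slice regular Moebius transformation\<close>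

text \<open>In commuting coefficients the star product is the ordinary Cauchy product, here of a
  geometric series with the polynomial \<open>a - z\<close>. The conditional matches the coefficient
  sequence in \<open>moebius\<close>.\<close>

lemma Cauchy_product_disc_moebius:
  assumes a: "norm a < 1" and z: "z \<in> ball 0 1"
  shows "(\<lambda>n. z ^ n * (\<Sum>k\<le>n. cnj a ^ k * (if n - k = 0 then a else if n - k = 1 then - 1 else 0)))
    sums disc_moebius a z"
proof -
  define m where "m n = (if n = 0 then a else if n = 1 then - 1 else 0)" for n :: nat
  have "norm (cnj a * z) \<le> norm a"
    using z by (simp add: norm_mult mult_left_le)
  then have c: "norm (cnj a * z) < 1" using a by simp
  have "(\<lambda>k. m k * z ^ k) sums (\<Sum>k\<in>{0,1}. m k * z ^ k)"
    by (rule sums_finite) (auto simp: m_def)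
  then have b: "(\<Sum>k. m k * z ^ k) = a - z"
    by (simp add: m_def sums_iff)
  have "summable (\<lambda>k. norm (m k * z ^ k))"
    by (rule summable_finite[of "{0,1}"]) (auto simp: m_def)
  moreover have "summable (\<lambda>k. norm ((cnj a * z) ^ k))"
    using c by (simp add: norm_power summable_geometric)
  ultimately have "(\<lambda>n. \<Sum>k\<le>n. (cnj a * z) ^ k * (m (n - k) * z ^ (n - k))) sums
      ((\<Sum>k. (cnj a * z) ^ k) * (\<Sum>k. m k * z ^ k))"
    by (intro Cauchy_product_sums)
  also have "(\<Sum>k. (cnj a * z) ^ k) * (\<Sum>k. m k * z ^ k) = disc_moebius a z"
    unfolding b suminf_geometric[OF c] by (simp add: disc_moebius_def)
  also have "(\<lambda>n. \<Sum>k\<le>n. (cnj a * z) ^ k * (m (n - k) * z ^ (n - k)))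
      = (\<lambda>n. z ^ n * (\<Sum>k\<le>n. cnj a ^ k * m (n - k)))"
  proof
    fix n
    have "(cnj a * z) ^ k * (m (n - k) * z ^ (n - k)) = z ^ n * (cnj a ^ k * m (n - k))" if "k \<le> n" for k
    proof -
      have "z ^ n = z ^ k * z ^ (n - k)" using that by (simp flip: power_add)
      then show ?thesis by (simp add: power_mult_distrib mult_ac)
    qed
    then show "(\<Sum>k\<le>n. (cnj a * z) ^ k * (m (n - k) * z ^ (n - k))) = z ^ n * (\<Sum>k\<le>n. cnj a ^ k * m (n - k))"
      unfolding sum_distrib_left by (intro sum.cong) auto
  qed
  finally show ?thesis unfolding m_def .
qed

lemma moebius_slice_embed:
  assumes i: "i \<in> imag_units" and a: "norm a < 1" and z: "z \<in> ball 0 1"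
  shows "moebius (slice_embed i a) (slice_embed i z) = slice_embed i (disc_moebius a z)"
proof -
  note lin = bounded_linear_slice_embed[of i]
  note lin' = bounded_linear.linear[OF lin]
  have cnj: "qcnj (slice_embed i a) = slice_embed i (cnj a)"
    using imag_unitsD(1)[OF i] by (simp add: slice_embed_altdef qcnj_def quat_eq_iff quat_defs)
  have m1: "slice_embed i (- 1) = - 1" and m0: "slice_embed i 0 = 0"
    using linear_0[OF lin'] linear_neg[OF lin', of 1] slice_embed_1[OF i] by simp_all
  define m :: "nat \<Rightarrow> complex" where "m n = (if n = 0 then a else if n = 1 then - 1 else 0)" for n
  have m: "(if n = 0 then slice_embed i a else if n = 1 then - 1 else 0) = slice_embed i (m n)" for n
    by (simp add: m_def m1 m0)
  have "moebius (slice_embed i a) (slice_embed i z)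
      = (\<Sum>n. slice_embed i (z ^ n * (\<Sum>k\<le>n. cnj a ^ k * m (n - k))))"
    unfolding moebius_def qpowser_def star_prod_def cnj m
    by (simp add: slice_embed_mult[OF i] slice_embed_power[OF i] linear_sum[OF lin'])
  also have "\<dots> = slice_embed i (disc_moebius a z)"
    using bounded_linear.sums[OF lin Cauchy_product_disc_moebius[OF a z]]
    unfolding m_def by (simp add: sums_iff)
  finally show ?thesis .
qed

lemma slice_extend_eq: "slice_extend i h q = slice_ext i (\<lambda>z. h (slice_embed i z)) q"
  by (simp add: slice_extend_def slice_ext_def Let_def slice_embed_altdef slice_coord_def of_real_def)

lemma slice_ext_cong:
  assumes "q \<in> ball 0 1" "\<And>z. z \<in> ball 0 1 \<Longrightarrow> G z = H z"
  shows "slice_ext i G q = slice_ext i H q"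
  using assms(2)[of "slice_coord q"] assms(2)[of "cnj (slice_coord q)"] assms(1)
  by (simp add: slice_ext_def norm_slice_coord)

lemma slice_ext_add_mult:
  "slice_ext i G q + slice_ext i H q * j = slice_ext i (\<lambda>z. G z + H z * j) q"
  by (simp add: slice_ext_def scaleR_add_right[symmetric] distrib_left distrib_right mult.assoc)

section \<open>Splitting and norm comparison for the slice composition\<close>

context
  fixes i j :: quat
  assumes i: "i \<in> imag_units" and j: "j \<in> imag_units" and ij: "i \<bullet> j = 0"
begin

text \<open>Both components are definite descriptions; the required uniqueness is the injectivity of
  \<open>quat_join\<close>.\<close>

lemma split_slice_embed:
  assumes f: "f (slice_embed i z) = quat_join i j u v" and z: "z \<in> ball 0 1"
  shows "split_fst i j f (slice_embed i z) = slice_embed i u"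
    and "split_snd i j f (slice_embed i z) = slice_embed i v"
proof -
  have Q: "slice_restrict i f (slice_embed i z) = slice_embed i u + slice_embed i v * j"
    using f z by (simp add: slice_restrict_def slice_embed_in_slice_ball_iff[OF i] quat_join_def)
  have uniq: "u' = slice_embed i u \<and> v' = slice_embed i v"
    if uv: "u' \<in> slice i" "v' \<in> slice i" "slice_embed i u + slice_embed i v * j = u' + v' * j" for u' v'
  proof -
    obtain x y where "u' = slice_embed i x" "v' = slice_embed i y"
      using uv(1,2) unfolding slice_def by blast
    then show ?thesis
      using uv(3) quat_join_eq_iff[OF i j ij, of u v x y] unfolding quat_join_def by simp
  qed
  have s: "slice_embed i w \<in> slice i" for w by (simp add: slice_def)
  show "split_fst i j f (slice_embed i z) = slice_embed i u"
    unfolding split_fst_def Q using s uniq by (intro the_equality) blast+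
  show "split_snd i j f (slice_embed i z) = slice_embed i v"
    unfolding split_snd_def Q using s uniq by (intro the_equality) blast+
qed

text \<open>The extension is additive and right linear, so the factor \<open>j\<close> moves inside
  and the two extensions merge into one, to which \<open>slice_ext_slice_regular\<close>
  applies.\<close>

lemma slice_comp_moebius_eq:
  assumes f: "\<And>z. z \<in> ball 0 1 \<Longrightarrow> f (slice_embed i z) = quat_join i j (A z) (B z)"
    and a: "norm a < 1" and q: "q \<in> ball 0 1"
  shows "slice_comp_moebius i j f (slice_embed i a) q
    = slice_ext i (\<lambda>z. quat_join i j (A (disc_moebius a z)) (B (disc_moebius a z))) q"
proof -
  have Q: "slice_restrict i (moebius (slice_embed i a)) (slice_embed i z) = slice_embed i (disc_moebius a z)"
    if "z \<in> ball 0 1" for z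
    using that slice_embed_in_slice_ball_iff[OF i, of z] moebius_slice_embed[OF i a that]
    by (simp add: slice_restrict_def)
  have split: "split_fst i j f (slice_embed i w) = slice_embed i (A w)"
    "split_snd i j f (slice_embed i w) = slice_embed i (B w)" if "w \<in> ball 0 1" for w
    using split_slice_embed[of f w "A w" "B w", OF f[OF that] that] by auto
  show ?thesis
    unfolding slice_comp_moebius_def slice_extend_eq slice_ext_add_mult
    by (rule slice_ext_cong[OF q])
       (simp only: o_def Q split[OF disc_moebius_in_ball[OF a]] quat_join_def)
qed

lemma norm_quat_join_ge: "norm u \<le> norm (quat_join i j u v)" "norm v \<le> norm (quat_join i j u v)"
proof -
  have "(norm u)\<^sup>2 \<le> (norm (quat_join i j u v))\<^sup>2" "(norm v)\<^sup>2 \<le> (norm (quat_join i j u v))\<^sup>2"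
    unfolding norm_quat_join[OF i j ij] by simp_all
  then show "norm u \<le> norm (quat_join i j u v)" "norm v \<le> norm (quat_join i j u v)"
    by (auto intro: power2_le_imp_le)
qed

lemma norm_quat_join_le: "norm (quat_join i j u v) \<le> norm u + norm v"
  unfolding quat_join_def
  using norm_triangle_ineq[of "slice_embed i u" "slice_embed i v * j"]
  by (simp add: norm_mult norm_slice_embed[OF i] imag_unitsD(3)[OF j])

lemma besov_density_le_quat_join:
  assumes p: "p > 0"
  shows "besov_density p n A z \<le> ennreal (norm (of_real ((1 - (norm z)\<^sup>2) ^ n) * quat_join i j (A z) (B z)) powr p)"
    and "besov_density p n B z \<le> ennreal (norm (of_real ((1 - (norm z)\<^sup>2) ^ n) * quat_join i j (A z) (B z)) powr p)"
proof -
  have *: "ennreal (((1 - (norm z)\<^sup>2) ^ n * norm w) powr p) * indicator (ball 0 1) z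
      \<le> ennreal (norm (of_real ((1 - (norm z)\<^sup>2) ^ n) * x) powr p)"
    if "norm w \<le> norm x" for w :: complex and x :: quat
  proof (cases "z \<in> ball 0 1")
    case True
    then have "0 < (1 - (norm z)\<^sup>2) ^ n" using one_minus_norm_bounds(4)[OF True] by simp
    then have "((1 - (norm z)\<^sup>2) ^ n * norm w) powr p \<le> norm (of_real ((1 - (norm z)\<^sup>2) ^ n) * x) powr p"
      using p that unfolding norm_mult norm_of_real by (intro powr_mono2 mult_mono) auto
    then show ?thesis using True by (simp add: ennreal_leI)
  qed simp
  show "besov_density p n A z \<le> ennreal (norm (of_real ((1 - (norm z)\<^sup>2) ^ n) * quat_join i j (A z) (B z)) powr p)"
    unfolding besov_density_def by (intro * norm_quat_join_ge)
  show "besov_density p n B z \<le> ennreal (norm (of_real ((1 - (norm z)\<^sup>2) ^ n) * quat_join i j (A z) (B z)) powr p)"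
    unfolding besov_density_def by (intro * norm_quat_join_ge)
qed

lemma quat_join_le_besov_density:
  assumes p: "p > 0" and z: "z \<in> ball 0 1"
  shows "ennreal (norm (of_real ((1 - (norm z)\<^sup>2) ^ n) * quat_join i j (A z) (B z)) powr p)
    \<le> ennreal (2 powr p) * (besov_density p n A z + besov_density p n B z)"
proof -
  define s where "s = (1 - (norm z)\<^sup>2) ^ n"
  have s: "s \<ge> 0" using one_minus_norm_bounds(4)[OF z] by (simp add: s_def)
  have "norm (of_real s * quat_join i j (A z) (B z)) \<le> s * (norm (A z) + norm (B z))"
    using s norm_quat_join_le by (simp add: norm_mult mult_left_mono)
  then have "norm (of_real s * quat_join i j (A z) (B z)) powr p \<le> (s * norm (A z) + s * norm (B z)) powr p"
    using p by (intro powr_mono2) (auto simp: distrib_left)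
  also have "\<dots> \<le> 2 powr p * ((s * norm (A z)) powr p + (s * norm (B z)) powr p)"
    \<comment> \<open>\<open>bool\<close> serves as a two-element index set, whose cardinality gives
      the factor \<open>2 powr p\<close>.\<close>
    using powr_sum_le[of "UNIV :: bool set" "\<lambda>b. if b then s * norm (A z) else s * norm (B z)" p] s p
    by (simp add: UNIV_bool add.commute)
  finally show ?thesis
    using z by (simp add: besov_density_def s_def[symmetric] ennreal_mult'[symmetric] ennreal_leI flip: ennreal_plus)
qed

end

section \<open>Assembly on the slice and in the ball\<close>

theorem proposition4p7:
  fixes p :: real and i j a :: quat and f :: "quat \<Rightarrow> quat"
  assumes "p > 0"
    and "i \<in> imag_units"
    and "j \<in> imag_units" and "i \<bullet> j = 0"
    and "a \<in> slice_ball i"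
    and "f \<in> besov p i"
  shows "slice_comp_moebius i j f a \<in> besov p i"
proof -
  note p = assms(1) and i = assms(2) and frame = assms(2-4)
  obtain \<alpha> where \<alpha>: "a = slice_embed i \<alpha>"
    using assms(5) by (auto simp: slice_ball_def slice_def)
  with assms(5) have \<alpha>1: "norm \<alpha> < 1"
    using slice_embed_in_slice_ball_iff[OF i, of \<alpha>] by simp
  have f: "f \<in> slice_regular" using assms(6) by (simp add: besov_def)
  obtain n :: nat where n: "real n * p > 1" and fin:
    "(\<integral>\<^sup>+ z. ennreal (norm (of_real ((1 - (norm z)\<^sup>2) ^ n)
                * (deriv_x0 ^^ n) f (slice_embed i z)) powr p) \<partial>disc_lambda) < \<infinity>"
    using assms(6) unfolding besov_def by blast
  obtain A B where A: "A holomorphic_on ball 0 1" and B: "B holomorphic_on ball 0 1"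
    and AB: "\<And>z. z \<in> ball 0 1 \<Longrightarrow> f (slice_embed i z) = quat_join i j (A z) (B z)"
    using slice_regular_imp_quat_join[OF frame f] by blast
  note derivs = deriv_x0_funpow_quat_join[OF frame A B AB]
  \<comment> \<open>The formula for the derivatives is available only in the open disc, which
    carries all of \<open>disc_lambda\<close>.\<close>
  have AE_f: "AE z in disc_lambda. (deriv_x0 ^^ n) f (slice_embed i z)
      = quat_join i j ((deriv ^^ n) A z) ((deriv ^^ n) B z)"
    using AE_disc_lambda by eventually_elim (rule derivs)
  have finA: "(\<integral>\<^sup>+z. besov_density p n ((deriv ^^ n) A) z \<partial>disc_lambda) < \<infinity>"
  proof (rule le_less_trans[OF nn_integral_mono_AE fin])
    show "AE z in disc_lambda. besov_density p n ((deriv ^^ n) A) z \<le> ennreal (norm (of_real ((1 - (norm z)\<^sup>2) ^ n)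
                * (deriv_x0 ^^ n) f (slice_embed i z)) powr p)"
      using AE_f by eventually_elim (simp only: besov_density_le_quat_join[OF frame p])
  qed
  have finB: "(\<integral>\<^sup>+z. besov_density p n ((deriv ^^ n) B) z \<partial>disc_lambda) < \<infinity>"
  proof (rule le_less_trans[OF nn_integral_mono_AE fin])
    show "AE z in disc_lambda. besov_density p n ((deriv ^^ n) B) z \<le> ennreal (norm (of_real ((1 - (norm z)\<^sup>2) ^ n)
                * (deriv_x0 ^^ n) f (slice_embed i z)) powr p)"
      using AE_f by eventually_elim (simp only: besov_density_le_quat_join[OF frame p])
  qed
  \<comment> \<open>The least integer surplus \<open>m - n\<close> with
    \<open>(m - n) * p \<ge> 2\<close>; as \<open>m \<ge> n\<close>, the admissibility condition
    \<open>m * p > 1\<close> is inherited from \<open>n\<close>.\<close>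
  define m where "m = n + nat \<lceil>2 / p\<rceil>"
  have "2 / p \<le> real (m - n)" unfolding m_def by simp linarith
  then have mn: "n \<le> m" "real (m - n) * p \<ge> 2"
    using p by (simp_all only: pos_divide_le_eq m_def le_add1)
  have "real n * p \<le> real m * p" using mn p by (intro mult_right_mono) auto
  then have m1: "real m * p > 1" using n by linarith
  define T where "T = disc_moebius \<alpha>"
  define g where "g = slice_comp_moebius i j f a"
  have T: "T holomorphic_on ball 0 1"
    unfolding T_def
    by (rule holomorphic_on_subset[OF disc_moebius_holomorphic order_trans[OF ball_subset_cball ball_subset_disc_moebius_domain[OF \<alpha>1]]])
  have Tb: "T ` ball 0 1 \<subseteq> ball 0 1"
    using disc_moebius_in_ball[OF \<alpha>1] unfolding T_def by blast
  have AT: "(A \<circ> T) holomorphic_on ball 0 1" and BT: "(B \<circ> T) holomorphic_on ball 0 1"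
    using holomorphic_on_compose_gen[OF T _ Tb] A B by auto
  have g: "g q = slice_ext i (\<lambda>z. quat_join i j ((A \<circ> T) z) ((B \<circ> T) z)) q" if "q \<in> ball 0 1" for q
    using slice_comp_moebius_eq[of i j f A B \<alpha> q, OF frame AB \<alpha>1 that] by (simp add: g_def T_def \<alpha>)
  have "g \<in> slice_regular"
  proof (rule slice_ext_slice_regular[OF i _ g])
    fix z :: complex assume z: "z \<in> ball 0 1"
    show "((\<lambda>z. quat_join i j ((A \<circ> T) z) ((B \<circ> T) z)) has_derivative
        (\<lambda>h. slice_embed i h * quat_join i j (deriv (A \<circ> T) z) (deriv (B \<circ> T) z))) (at z)"
      by (rule has_derivative_quat_join[OF frame holomorphic_derivI[OF AT open_ball z] holomorphic_derivI[OF BT open_ball z]])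
  qed
  \<comment> \<open>On its own slice the extension restores the given function: for
    \<open>I = i\<close> the factors are \<open>1 + i * i = 0\<close> and
    \<open>1 - i * i = 2\<close>.\<close>
  have gs: "g (slice_embed i z) = quat_join i j ((A \<circ> T) z) ((B \<circ> T) z)" if "z \<in> ball 0 1" for z
    using g[of "slice_embed i z"] that imag_unitsD(5)[OF i]
    by (simp add: norm_slice_embed[OF i] slice_ext_on_slice[OF i] flip: scaleR_2)
  have hol: "(deriv ^^ m) (A \<circ> T) holomorphic_on ball 0 1" "(deriv ^^ m) (B \<circ> T) holomorphic_on ball 0 1"
    using AT BT by (auto intro: holomorphic_higher_deriv)
  note [measurable] = besov_density_measurable[OF hol(1) p] besov_density_measurable[OF hol(2) p]
  have "(\<integral>\<^sup>+ z. ennreal (norm (of_real ((1 - (norm z)\<^sup>2) ^ m)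
                * (deriv_x0 ^^ m) g (slice_embed i z)) powr p) \<partial>disc_lambda)
      \<le> (\<integral>\<^sup>+ z. ennreal (2 powr p) * (besov_density p m ((deriv ^^ m) (A \<circ> T)) z
            + besov_density p m ((deriv ^^ m) (B \<circ> T)) z) \<partial>disc_lambda)"
  proof (rule nn_integral_mono_AE)
    show "AE z in disc_lambda. ennreal (norm (of_real ((1 - (norm z)\<^sup>2) ^ m)
                * (deriv_x0 ^^ m) g (slice_embed i z)) powr p)
        \<le> ennreal (2 powr p) * (besov_density p m ((deriv ^^ m) (A \<circ> T)) z
            + besov_density p m ((deriv ^^ m) (B \<circ> T)) z)"
      using AE_disc_lambda
    proof eventually_elim
      case (elim z)
      have "(deriv_x0 ^^ m) g (slice_embed i z) = quat_join i j ((deriv ^^ m) (A \<circ> T) z) ((deriv ^^ m) (B \<circ> T) z)"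
        by (rule deriv_x0_funpow_quat_join[OF frame AT BT gs elim])
      then show ?case
        using quat_join_le_besov_density[OF frame p elim] by simp
    qed
  qed
  also have "\<dots> = ennreal (2 powr p) * ((\<integral>\<^sup>+ z. besov_density p m ((deriv ^^ m) (A \<circ> T)) z \<partial>disc_lambda)
      + (\<integral>\<^sup>+ z. besov_density p m ((deriv ^^ m) (B \<circ> T)) z \<partial>disc_lambda))"
    by (simp add: nn_integral_cmult nn_integral_add)
  also have "\<dots> < \<infinity>"
    using besov_compose_disc_moebius[OF \<alpha>1 A p finA mn] besov_compose_disc_moebius[OF \<alpha>1 B p finB mn]
    by (simp add: T_def ennreal_mult_less_top)
  finally show ?thesis
    using \<open>g \<in> slice_regular\<close> m1 unfolding besov_def g_def by blast
qed

end
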